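(* Let $T\ge 2$ be an integer, $\mathcal{T}=\{1,\dots,T\}$, and consider the general model described in the context. Then: (i) For each $t\in\mathcal{T}$ with $t\le T-1$, as $\alpha\to\infty$, $$\widehat{f}_{t}:=\frac{\sum_{i=1}^{T-t}C^{\alpha}_{i,t+1}}{\sum_{i=1}^{T-t}C^{\alpha}_{i,t}}\xrightarrow{\text{a.s.}} \frac{\operatorname{E}[ZI\{D\le t+1\}]}{\operatorname{E}[ZI\{D\le t\}]}=:f_{t}.$$ (ii) For each $i\in\mathcal{T}$ with $i\ge 2$, as $\alpha\to\infty$, $$\frac{C^{\alpha}_{i,T-i+1}\prod_{t=T-i+1}^{T-1}\widehat{f}_t}{C^{\alpha}_{i,T}}\xrightarrow{\text{a.s.}} 1.$$ (iii) For each $t\in\mathcal{T}$ with $t\le T-2$, as $\alpha\to\infty$, $$\widehat{\sigma}^2_{t}:=\frac{1}{T-t-1}\sum_{i=1}^{T-t}C^{\alpha}_{i,t}\bigg(\frac{C^{\alpha}_{i,t+1}}{C^{\alpha}_{i,t}}-\widehat{f}_{t}\bigg)^2\xrightarrow{d}\sigma^2_t\,\frac{\chi^2_{T-t-1}}{T-t-1},$$ where $\chi^2_\nu$ denotes a random variable with a chi-squared distribution with $\nu$ degrees of freedom and $$\sigma^2_t=(f_t-1)\bigg(\frac{\operatorname{E}[Z^2I\{D=t+1\}]}{\operatorname{E}[ZI\{D=t+1\}]}+(f_t-1)\frac{\operatorname{E}[Z^2I\{D\le t\}]}{\operatorname{E}[ZI\{D\le t\}]}\bigg).$$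
   Context: General model. Fix an integer $T\ge2$ and $\mathcal{T}=\{1,\dots,T\}$ (accident years $i$ and development years $t$). For each $i\in\mathcal{T}$ there is a family of nonnegative integer-valued random variables $(M^{\alpha}_i)_{\alpha\ge0}$ (number of claims of accident year $i$ at exposure $\alpha$) and a sequence of random pairs $(D_{i,k},Z_{i,k})_{k\ge1}$ with $D_{i,k}\in\mathcal{T}$ (development year) and $Z_{i,k}$ real (claim size). Define, for $i,t\in\mathcal{T}$, $$C^{\alpha}_{i,t}=\sum_{k=1}^{M^{\alpha}_i}Z_{i,k}I\{D_{i,k}\le t\}.$$ Assumptions: (GM1) for each $i$, $(D_{i,k},Z_{i,k})_{k\ge1}$ is i.i.d., and the common distribution does not depend on $i$; with $(D,Z)$ a generic pair with this distribution, $\operatorname{E}[Z^2]<\infty$ and $\operatorname{E}[ZI\{D=t\}]>0$ for each $t\in\mathcal{T}$. (GM2) For each $i$, $(D_{i,k},Z_{i,k})_{k\ge1}$ is independent of $(M^{\alpha}_i)_{\alpha\ge 0}$. (GM3) The families $\{(M^{\alpha}_i)_{\alpha},(D_{i,k},Z_{i,k})_{k\ge1}\}$, $i=1,\dots,T$, are independent. (GM4) For each $i$ there is $\lambda_i\in(0,\infty)$ with $M^{\alpha}_i/\alpha\to\lambda_i$ almost surely as $\alpha\to\infty$. $I\{\cdot\}$ denotes an indicator. The components $D$ and $Z$ may be dependent. *)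

theory Defs
  imports "HOL-Probability.Probability"
begin

definition cum_claims ::
  "(nat \<Rightarrow> real \<Rightarrow> 'a \<Rightarrow> nat) \<Rightarrow> (nat \<Rightarrow> nat \<Rightarrow> 'a \<Rightarrow> nat) \<Rightarrow> (nat \<Rightarrow> nat \<Rightarrow> 'a \<Rightarrow> real)
   \<Rightarrow> nat \<Rightarrow> nat \<Rightarrow> real \<Rightarrow> 'a \<Rightarrow> real" where
  "cum_claims N D Z i t \<alpha> \<omega> =
     (\<Sum>k\<in>{1..N i \<alpha> \<omega>}. Z i k \<omega> * (if D i k \<omega> \<le> t then 1 else 0))"

definition fhat ::
  "nat \<Rightarrow> (nat \<Rightarrow> real \<Rightarrow> 'a \<Rightarrow> nat) \<Rightarrow> (nat \<Rightarrow> nat \<Rightarrow> 'a \<Rightarrow> nat) \<Rightarrow> (nat \<Rightarrow> nat \<Rightarrow> 'a \<Rightarrow> real)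
   \<Rightarrow> nat \<Rightarrow> real \<Rightarrow> 'a \<Rightarrow> real" where
  "fhat T N D Z t \<alpha> \<omega> =
     (\<Sum>i=1..T-t. cum_claims N D Z i (t+1) \<alpha> \<omega>) / (\<Sum>i=1..T-t. cum_claims N D Z i t \<alpha> \<omega>)"

definition sigma2hat ::
  "nat \<Rightarrow> (nat \<Rightarrow> real \<Rightarrow> 'a \<Rightarrow> nat) \<Rightarrow> (nat \<Rightarrow> nat \<Rightarrow> 'a \<Rightarrow> nat) \<Rightarrow> (nat \<Rightarrow> nat \<Rightarrow> 'a \<Rightarrow> real)
   \<Rightarrow> nat \<Rightarrow> real \<Rightarrow> 'a \<Rightarrow> real" where
  "sigma2hat T N D Z t \<alpha> \<omega> =
     1 / (real T - real t - 1) *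
     (\<Sum>i=1..T-t. cum_claims N D Z i t \<alpha> \<omega> *
        (cum_claims N D Z i (t+1) \<alpha> \<omega> / cum_claims N D Z i t \<alpha> \<omega> - fhat T N D Z t \<alpha> \<omega>)\<^sup>2)"

text \<open>Independence of two random variables X (values in S) and Y (values in S'), possibly of
  different types (the library's indep_var requires equal types); this is the unfolding of indep_var.\<close>
definition indep_rvs :: "'a measure \<Rightarrow> 'b measure \<Rightarrow> ('a \<Rightarrow> 'b) \<Rightarrow> 'c measure \<Rightarrow> ('a \<Rightarrow> 'c) \<Rightarrow> bool" where
  "indep_rvs M S X S' Y \<longleftrightarrow>
     X \<in> measurable M S \<and> Y \<in> measurable M S' \<and>
     prob_space.indep_set M
       (sigma_sets (space M) {X -` A \<inter> space M | A. A \<in> sets S})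
       (sigma_sets (space M) {Y -` A \<inter> space M | A. A \<in> sets S'})"

definition chi_squared_density :: "nat \<Rightarrow> real \<Rightarrow> real" where
  "chi_squared_density k x =
     (if x > 0 then x powr (real k / 2 - 1) * exp (- x / 2) / (2 powr (real k / 2) * Gamma (real k / 2))
      else 0)"

definition chi_squared :: "nat \<Rightarrow> real measure" where
  "chi_squared k = density lborel (\<lambda>x. ennreal (chi_squared_density k x))"

definition conv_in_distr :: "'a measure \<Rightarrow> ('b \<Rightarrow> 'a \<Rightarrow> real) \<Rightarrow> 'b filter \<Rightarrow> real measure \<Rightarrow> bool" where
  "conv_in_distr M X F L \<longleftrightarrow>
     (\<forall>x. measure L {x} = 0 \<longrightarrow>
        ((\<lambda>b. measure M {\<omega> \<in> space M. X b \<omega> \<le> x}) \<longlongrightarrow> measure L {..x}) F)"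

end

(*
  Write S_i = C_{i,t+1} - f_t C_{i,t}, a sum of M_i centered claims W = Z (I{D <= t+1} - f_t I{D <= t}).
  Then

    sum_i C_{i,t} (C_{i,t+1} / C_{i,t} - fhat_t)^2 = sum_i S_i^2 / C_{i,t} - (sum_i S_i)^2 / sum_i C_{i,t}.

  By the strong law C_{i,t} / alpha tends to lambda_i E[Z I{D <= t}], which gives (i) and (ii). For (iii),
  the central limit theorem with an independent random index makes S_i / sqrt(M_i) asymptotically normal,
  independently over i, so the statistic converges to a multiple of |X|^2 - (b.X)^2 with X standard
  normal in dimension T - t and b the unit vector proportional to (sqrt(lambda_i)). This is the squared
  length of the projection of X onto the orthogonal complement of b, hence chi-squared with T - t - 1
  degrees of freedom.
*)
theory Submission
  imports Defs
begin

subsection \<open>The chi-squared law of a residual sum of squares\<close>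

text \<open>Scaling each residual by \<open>sqrt (M_i)\<close>, not by a multiple of
  \<open>sqrt \<alpha>\<close>, leaves a sum with a fixed number of terms once the count is given,
  so independence of counts and claims carries the central limit theorem over without any control of
  neighbouring indices. The price is that the statistic becomes a quadratic form in the scaled
  residuals whose coefficients \<open>M_i / C_{i,t}\<close> and
  \<open>sqrt (M_i M_j) / \<Sum>C\<close> are random and depend on the same claims as the residuals.
  Their almost sure limits are constants, however: replacing them costs at most |X|^2 times a null
  sequence, and |X|^2 is bounded in probability. Claim sizes are real and counts may vanish, so a
  denominator can be zero or negative; the algebraic identity is therefore used only where all
  \<open>C_{i,t}\<close> are positive, which almost surely holds eventually. Almost sure limits are
  obtained directly for real \<alpha>, because the strong law is evaluated only at the integer
  counts; convergence in distribution is obtained along sequences of exposures.\<close>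

lemma chi_squared_density_measurable [measurable]: "chi_squared_density k \<in> borel_measurable borel"
  unfolding chi_squared_density_def by measurable

lemma chi_squared_density_nonneg: "0 \<le> chi_squared_density k x"
  unfolding chi_squared_density_def by (cases "k = 0") auto

section \<open>Convolution of chi-squared densities\<close>

lemma nn_integral_Beta:
  assumes "a > 0" "b > (0::real)"
  shows "(\<integral>\<^sup>+t. ennreal (t powr (a - 1) * (1 - t) powr (b - 1)) * indicator {0<..<1} t \<partial>lborel) = ennreal (Beta a b)"
proof -
  have "((\<lambda>t. t powr (a - 1) * (1 - t) powr (b - 1)) has_integral Beta a b) {0<..<1}"
    using has_integral_Beta_real[OF assms] by (simp add: has_integral_Icc_iff_Ioo)
  then show ?thesis
    by (rule nn_integral_has_integral_lebesgue'[rotated]) auto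
qed

text \<open>The substitution y = x t pulls x out of the convolution integral and leaves a Beta
  integral; \<open>Beta a b = Gamma a * Gamma b / Gamma (a + b)\<close> then trades the two
  normalizing constants for one. Positive k and j make both parameters of the Beta integral
  positive.\<close>

lemma chi_squared_density_convolution:
  assumes "k > 0" "j > 0"
  shows "(\<integral>\<^sup>+y. ennreal (chi_squared_density k (x - y)) * ennreal (chi_squared_density j y) \<partial>lborel)
    = ennreal (chi_squared_density (k + j) x)"
proof (cases "x > 0")
  case False
  have "(\<integral>\<^sup>+y. ennreal (chi_squared_density k (x - y)) * ennreal (chi_squared_density j y) \<partial>lborel) = (\<integral>\<^sup>+y. 0 \<partial>(lborel::real measure))"
    by (rule nn_integral_cong) (use False in \<open>auto simp: chi_squared_density_def\<close>)
  then show ?thesis using False by (simp add: chi_squared_density_def)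
next
  case x: True
  define a b where "a = real j / 2" and "b = real k / 2"
  have ab: "a > 0" "b > 0" using assms by (auto simp: a_def b_def)
  define C where "C = exp (- x / 2) * x powr (a + b - 1) / (2 powr (a + b) * Gamma a * Gamma b)"
  have C: "C \<ge> 0" using ab unfolding C_def by (auto intro!: divide_nonneg_nonneg mult_nonneg_nonneg)
  \<comment> \<open>The arguments keep the form \<open>0 + x * t\<close> so that they match the
    affine change of variables literally. For t outside (0, 1) one of the two arguments is
    nonpositive, and both sides vanish.\<close>
  have eq: "ennreal x * (ennreal (chi_squared_density k (x - (0 + x * t))) * ennreal (chi_squared_density j (0 + x * t)))
      = ennreal C * (ennreal (t powr (a - 1) * (1 - t) powr (b - 1)) * indicator {0<..<1} t)" for t
  proof (cases "t \<in> {0<..<1}")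
    case True
    have p: "x - x * t = x * (1 - t)" "x * (1-t) > 0" "x * t > 0" using True x by (auto simp: algebra_simps)
    have "x * (chi_squared_density k (x * (1 - t)) * chi_squared_density j (x * t)) 
       = x * (x powr (b - 1) * x powr (a - 1)) * (exp (- (x * (1-t)) / 2) * exp (- (x * t) / 2)) / ((2 powr a * 2 powr b) * Gamma a * Gamma b) * (t powr (a - 1) * (1 - t) powr (b - 1))"
      using p True x unfolding chi_squared_density_def a_def[symmetric] b_def[symmetric]
      by (simp add: powr_mult mult_ac)
    also have "x * (x powr (b - 1) * x powr (a - 1)) = x powr (a + b - 1)"
      using x by (simp add: powr_add[symmetric] powr_mult_base algebra_simps)
    also have "exp (- (x * (1-t)) / 2) * exp (- (x * t) / 2) = exp (- x / 2)"
      by (simp add: exp_add[symmetric] field_simps)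
    also have "2 powr a * 2 powr b = (2::real) powr (a + b)" by (simp add: powr_add)
    finally have "x * (chi_squared_density k (x * (1 - t)) * chi_squared_density j (x * t)) = C * (t powr (a - 1) * (1 - t) powr (b - 1))"
      unfolding C_def by (simp add: mult_ac)
    then show ?thesis using True C p x
      by (simp add: ennreal_mult'[symmetric] chi_squared_density_nonneg)
  next
    case False
    have "x * t \<le> 0 \<or> x - x * t \<le> 0" using False x mult_le_cancel_left1[of x t] by (auto simp: mult_le_0_iff not_less)
    then show ?thesis using False by (auto simp: chi_squared_density_def)
  qed
  have "(\<integral>\<^sup>+y. ennreal (chi_squared_density k (x - y)) * ennreal (chi_squared_density j y) \<partial>lborel)
     = ennreal \<bar>x\<bar> * (\<integral>\<^sup>+t. ennreal (chi_squared_density k (x - (0 + x * t))) * ennreal (chi_squared_density j (0 + x * t)) \<partial>lborel)"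
    by (rule nn_integral_real_affine) (use x in auto)
  also have "\<dots> = (\<integral>\<^sup>+t. ennreal x * (ennreal (chi_squared_density k (x - (0 + x * t))) * ennreal (chi_squared_density j (0 + x * t))) \<partial>lborel)"
    using x by (subst nn_integral_cmult) auto
  also have "\<dots> = ennreal C * ennreal (Beta a b)"
    unfolding eq by (subst nn_integral_cmult) (auto simp: nn_integral_Beta ab)
  also have "\<dots> = ennreal (C * Beta a b)" by (simp add: C ennreal_mult')
  also have "C * Beta a b = chi_squared_density (k + j) x"
  proof -
    have "chi_squared_density (k + j) x = x powr (a + b - 1) * exp (- x / 2) / (2 powr (a + b) * Gamma (a + b))"
      using x by (simp add: chi_squared_density_def a_def b_def add_divide_distrib add_ac)
    moreover have "Gamma a \<noteq> 0" "Gamma b \<noteq> 0" using ab by (simp_all add: Gamma_real_pos less_imp_neq[THEN not_sym])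
    ultimately show ?thesis by (simp add: C_def Beta_def)
  qed
  finally show ?thesis .
qed

text \<open>Finiteness is a hypothesis rather than a computed total mass: where the lemma is
  applied, both factors are already identified with laws of sums of squares, hence with probability
  measures.\<close>

lemma chi_squared_convolution:
  assumes "k > 0" "j > 0" "finite_measure (chi_squared k)" "finite_measure (chi_squared j)"
  shows "(chi_squared k \<star> chi_squared j) = chi_squared (k + j)"
  using assms unfolding chi_squared_def
  by (subst convolution_density) (auto simp: chi_squared_density_convolution)

section \<open>Sums of squared standard normals\<close>

text \<open>The substitution y = x^2 is monotone on [0, n + 1]; monotone convergence extends it to
  the half-line, and the symmetry of the normal density turns twice the half-line into the full
  line. The constants agree because \<open>Gamma (1/2) = sqrt pi\<close>.\<close>

lemma chi_squared_1: "distr std_normal_distribution borel (\<lambda>x. x\<^sup>2) = chi_squared 1" (is "?L = ?R")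
proof (rule measure_eqI)
  show "sets ?L = sets ?R" by (simp add: chi_squared_def)
  fix A assume "A \<in> sets ?L"
  then have [measurable]: "A \<in> sets borel" by simp
  define g where "g y = indicator A y * ennreal (chi_squared_density 1 y)" for y
  have [measurable]: "g \<in> borel_measurable borel" unfolding g_def by measurable
  define h where "h x = indicator A (x\<^sup>2) * ennreal (std_normal_density x)" for x :: real
  have [measurable]: "h \<in> borel_measurable borel" unfolding h_def by measurable
  have gh: "g (x\<^sup>2) * ennreal (2 * x) = 2 * h x" if "x > 0" for x
  proof -
    have "(x\<^sup>2) powr (- 1 / 2) = 1 / x" using that by (simp add: powr_minus powr_half_sqrt divide_simps)
    then have "chi_squared_density 1 (x\<^sup>2) * (2 * x) = 2 * std_normal_density x"
      using that by (simp add: chi_squared_density_def std_normal_density_def Gamma_one_half_real powr_half_sqrt real_sqrt_mult)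
    then have "ennreal (chi_squared_density 1 (x\<^sup>2)) * ennreal (2 * x) = ennreal (2 * std_normal_density x)"
      by (subst ennreal_mult'[symmetric]) (use that in \<open>auto simp: chi_squared_density_nonneg\<close>)
    also have "\<dots> = 2 * ennreal (std_normal_density x)" by (simp add: ennreal_mult')
    finally show ?thesis unfolding g_def h_def by (auto simp: indicator_def mult_ac)
  qed
  have le_Suc: "y \<le> (real (Suc n) + 1)\<^sup>2" if "y \<le> (real n + 1)\<^sup>2" for y n
    by (rule order_trans[OF that]) (auto intro!: power_mono)
  \<comment> \<open>The origin is discarded twice: \<open>gh\<close> requires x > 0, and the two
    closed half-lines that are glued together at the end overlap there.\<close>
  have AE_ne: "AE x in lborel. x \<noteq> (0::real)" by (rule AE_lborel_singleton)
  have "emeasure ?R A = (\<integral>\<^sup>+y. g y \<partial>lborel)"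
    unfolding chi_squared_def g_def by (subst emeasure_density) (auto simp: mult.commute)
  also have "\<dots> = (\<integral>\<^sup>+y. (SUP n. g y * indicator {0..(real n+1)\<^sup>2} y) \<partial>lborel)"
  proof (rule nn_integral_cong)
    fix y :: real
    show "g y = (SUP n. g y * indicator {0..(real n+1)\<^sup>2} y)"
    proof (cases "y > 0")
      case True
      obtain n where "y \<le> real n" using real_arch_simple by blast
      also have "real n \<le> (real n + 1)\<^sup>2" by (simp add: power2_eq_square algebra_simps)
      finally have "g y \<le> (SUP n. g y * indicator {0..(real n+1)\<^sup>2} y)"
        using True by (intro SUP_upper2[of n]) auto
      moreover have "(SUP n. g y * indicator {0..(real n+1)\<^sup>2} y) \<le> g y"
        by (intro SUP_least) (auto simp: indicator_def)
      ultimately show ?thesis by (rule antisym)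
    next
      case False
      then have "g y = 0" by (simp add: g_def chi_squared_density_def)
      then show ?thesis by simp
    qed
  qed
  also have "\<dots> = (SUP n. \<integral>\<^sup>+y. g y * indicator {0..(real n+1)\<^sup>2} y \<partial>lborel)"
    by (rule nn_integral_monotone_convergence_SUP)
       (auto intro!: incseq_SucI le_funI simp: indicator_def le_Suc simp del: of_nat_Suc)
  also have "\<dots> = (SUP n. \<integral>\<^sup>+x. 2 * h x * indicator {0..real n+1} x \<partial>lborel)"
  proof (rule SUP_cong[OF refl])
    fix n :: nat
    have "(\<integral>\<^sup>+y. g y * indicator {0\<^sup>2..(real n+1)\<^sup>2} y \<partial>lborel) = (\<integral>\<^sup>+x. g (x\<^sup>2) * ennreal (2 * x) * indicator {0..real n+1} x \<partial>lborel)"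
      by (rule nn_integral_substitution_aux) (auto intro!: derivative_eq_intros continuous_intros)
    also have "\<dots> = (\<integral>\<^sup>+x. 2 * h x * indicator {0..real n+1} x \<partial>lborel)"
      by (rule nn_integral_cong_AE, use AE_ne in eventually_elim) (use gh in \<open>auto simp: indicator_def\<close>)
    finally show "(\<integral>\<^sup>+y. g y * indicator {0..(real n+1)\<^sup>2} y \<partial>lborel) = (\<integral>\<^sup>+x. 2 * h x * indicator {0..real n+1} x \<partial>lborel)" by simp
  qed
  also have "\<dots> = (\<integral>\<^sup>+x. (SUP n. 2 * h x * indicator {0..real n+1} x) \<partial>lborel)"
    by (rule nn_integral_monotone_convergence_SUP[symmetric])
       (auto intro!: incseq_SucI le_funI simp: indicator_def)
  also have "\<dots> = (\<integral>\<^sup>+x. 2 * (h x * indicator {0..} x) \<partial>lborel)"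
  proof (rule nn_integral_cong)
    fix x :: real
    show "(SUP n. 2 * h x * indicator {0..real n+1} x) = 2 * (h x * indicator {0..} x)"
    proof (cases "x \<ge> 0")
      case True
      obtain n where "x \<le> real n" using real_arch_simple by blast
      then have "2 * h x \<le> (SUP n. 2 * h x * indicator {0..real n+1} x)"
        using True by (intro SUP_upper2[of n]) auto
      moreover have "(SUP n. 2 * h x * indicator {0..real n+1} x) \<le> 2 * h x"
        by (intro SUP_least) (auto simp: indicator_def)
      ultimately show ?thesis using True by (auto intro: antisym)
    qed auto
  qed
  also have "\<dots> = (\<integral>\<^sup>+x. h x * indicator {0..} x \<partial>lborel) + (\<integral>\<^sup>+x. h x * indicator {0..} x \<partial>lborel)"
    by (subst nn_integral_cmult) (auto simp: mult_2)
  \<comment> \<open>The second copy is reflected by x -> -x, so that it covers the negative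
    half-line.\<close>
  also have "(\<integral>\<^sup>+x. h x * indicator {0..} x \<partial>lborel) + (\<integral>\<^sup>+x. h x * indicator {0..} x \<partial>lborel)
    = (\<integral>\<^sup>+x. h x * indicator {0..} x \<partial>lborel) + (\<integral>\<^sup>+x. h (0 + (-1) * x) * indicator {0..} (0 + (-1) * x) \<partial>lborel)"
    by (subst (2) nn_integral_real_affine[where c="-1" and t=0]) auto
  also have "\<dots> = (\<integral>\<^sup>+x. h x * indicator {0..} x + h (0 + (-1) * x) * indicator {0..} (0 + (-1) * x) \<partial>lborel)"
    by (rule nn_integral_add[symmetric]) auto
  also have "\<dots> = (\<integral>\<^sup>+x. h x \<partial>lborel)"
    by (rule nn_integral_cong_AE, use AE_ne in eventually_elim) (auto simp: indicator_def h_def std_normal_density_def)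
  also have "\<dots> = (\<integral>\<^sup>+x. indicator ((\<lambda>x. x\<^sup>2) -` A) x * ennreal (std_normal_density x) \<partial>lborel)"
    by (auto simp: h_def indicator_def intro!: nn_integral_cong)
  also have "\<dots> = emeasure ?L A"
  proof -
    have "(\<lambda>x::real. x\<^sup>2) -` A \<in> sets borel" using measurable_sets_borel[of "\<lambda>x::real. x\<^sup>2" borel A] by simp
    then show ?thesis by (subst emeasure_distr) (simp_all add: emeasure_density mult.commute)
  qed
  finally show "emeasure ?L A = emeasure ?R A" by simp
qed

lemma prob_space_std_normal: "prob_space std_normal_distribution"
  using real_dist_normal_dist by (simp add: real_distribution_def)

text \<open>The law of a sum of \<open>k\<close> squared independent standard normals; unlike \<^const>\<open>chi_squared\<close>,
  it makes sense for \<open>k = 0\<close>, where the density formula degenerates because \<open>Gamma 0 = 0\<close>.\<close>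

primrec sum_squares_law :: "nat \<Rightarrow> real measure" where
  "sum_squares_law 0 = return borel 0"
| "sum_squares_law (Suc k) = (sum_squares_law k \<star> distr std_normal_distribution borel (\<lambda>x. x\<^sup>2))"

lemma sets_sum_squares_law [simp, measurable_cong]: "sets (sum_squares_law k) = sets borel"
  by (cases k) auto

lemma prob_space_convolution:
  assumes "prob_space M" "prob_space N" "sets M = sets borel" "sets N = sets borel"
  shows "prob_space (M \<star> N)"
proof -
  interpret M: prob_space M by fact
  interpret N: prob_space N by fact
  interpret P: pair_prob_space M N ..
  note [measurable_cong] = assms(3,4)
  show ?thesis unfolding convolution_def by (rule P.prob_space_distr) measurable
qed

lemma prob_space_square_std_normal: "prob_space (distr std_normal_distribution borel (\<lambda>x. x\<^sup>2))"
  by (rule prob_space.prob_space_distr[OF prob_space_std_normal]) auto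

lemma prob_space_sum_squares_law: "prob_space (sum_squares_law k)"
proof (induction k)
  case 0
  then show ?case by (simp add: prob_space_return)
next
  case (Suc k)
  then show ?case by (auto intro!: prob_space_convolution prob_space_square_std_normal)
qed

lemma sum_squares_law_eq_chi_squared: "k > 0 \<Longrightarrow> sum_squares_law k = chi_squared k"
proof (induction k)
  case (Suc k)
  show ?case
  proof (cases "k = 0")
    case True
    \<comment> \<open>The point mass at 0 is neutral for convolution. This is the effective base
      case, since the identity itself fails for zero degrees of freedom.\<close>
    have "(return borel 0 \<star> chi_squared 1) = chi_squared 1"
    proof (rule measure_eqI)
      interpret c1: prob_space "chi_squared 1"
        using prob_space_square_std_normal by (simp add: chi_squared_1)
      fix A :: "real set" assume "A \<in> sets (return borel 0 \<star> chi_squared 1)"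
      then have [measurable]: "A \<in> sets borel" by simp
      have c1_sets: "sets (chi_squared 1) = sets borel" by (simp add: chi_squared_def)
      have "finite_measure (return borel (0::real))"
        by (intro prob_space.finite_measure prob_space_return) simp
      then have "emeasure (return borel 0 \<star> chi_squared 1) A = (\<integral>\<^sup>+x. \<integral>\<^sup>+y. indicator A (x + y) \<partial>chi_squared 1 \<partial>return borel 0)"
        by (intro convolution_emeasure') (use c1.finite_measure_axioms \<open>finite_measure (return borel 0)\<close> \<open>A \<in> sets borel\<close> c1_sets in simp_all)
      also have "\<dots> = (\<integral>\<^sup>+y. indicator A (0 + y) \<partial>chi_squared 1)"
      proof (rule nn_integral_return)
        note [measurable_cong] = c1_sets
        show "(\<lambda>x. \<integral>\<^sup>+ y. indicator A (x + y) \<partial>chi_squared 1) \<in> borel_measurable borel"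
          by measurable
      qed simp
      also have "\<dots> = (\<integral>\<^sup>+y. indicator A y \<partial>chi_squared 1)" by simp
      also have "\<dots> = emeasure (chi_squared 1) A"
        by (rule nn_integral_indicator) (simp add: c1_sets del: One_nat_def)
      finally show "emeasure (return borel 0 \<star> chi_squared 1) A = emeasure (chi_squared 1) A" .
    qed (simp add: chi_squared_def)
    then show ?thesis using True by (simp add: chi_squared_1)
  next
    case False
    then have "sum_squares_law k = chi_squared k" using Suc by simp
    moreover have "finite_measure (sum_squares_law k)" "finite_measure (chi_squared 1)"
      using prob_space_sum_squares_law[of k] prob_space_square_std_normal by (auto simp: prob_space_def chi_squared_1)
    ultimately show ?thesis using False chi_squared_convolution[of k 1] by (simp add: chi_squared_1)
  qed
qed simp

section \<open>Reflection invariance of the planar normal law\<close>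

text \<open>The map (x, y) -> (B x + b y, b x - B y) is an orthogonal reflection, so it preserves
  x^2 + y^2 and with it the product density. The change of variables is carried out by two
  one-dimensional affine substitutions joined by Fubini, whose Jacobians 1 / B and B cancel; this is
  why B must be nonzero.\<close>

lemma nn_integral_std_normal_reflection:
  fixes h :: "real \<Rightarrow> real \<Rightarrow> ennreal"
  assumes "B > 0" "B\<^sup>2 + b\<^sup>2 = 1"
    and [measurable]: "case_prod h \<in> borel_measurable (borel \<Otimes>\<^sub>M borel)"
  shows "(\<integral>\<^sup>+x. \<integral>\<^sup>+y. h (B * x + b * y) (b * x - B * y) \<partial>std_normal_distribution \<partial>std_normal_distribution)
    = (\<integral>\<^sup>+u. \<integral>\<^sup>+v. h u v \<partial>std_normal_distribution \<partial>std_normal_distribution)"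
proof -
  define p where "p u v = ennreal (std_normal_density u) * ennreal (std_normal_density v)" for u v
  have p: "p (B * x + b * y) (b * x - B * y) = p x y" for x y
  proof -
    have "(B * x + b * y)\<^sup>2 + (b * x - B * y)\<^sup>2 = (B\<^sup>2 + b\<^sup>2) * (x\<^sup>2 + y\<^sup>2)"
      by (simp add: power2_eq_square algebra_simps)
    then have "(B * x + b * y)\<^sup>2 + (b * x - B * y)\<^sup>2 = x\<^sup>2 + y\<^sup>2" using assms by simp
    then have "exp (- (B * x + b * y)\<^sup>2 / 2) * exp (- (b * x - B * y)\<^sup>2 / 2) = exp (- x\<^sup>2 / 2) * exp (- y\<^sup>2 / 2)"
      unfolding exp_add[symmetric] by (intro arg_cong[of _ _ exp]) (simp add: field_simps)
    then have "std_normal_density (B * x + b * y) * std_normal_density (b * x - B * y) = std_normal_density x * std_normal_density y"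
      by (simp add: std_normal_density_def)
    then show ?thesis by (simp add: p_def ennreal_mult'[symmetric])
  qed
  define H where "H u v = p u v * h u v" for u v
  have [measurable]: "case_prod H \<in> borel_measurable (borel \<Otimes>\<^sub>M borel)"
    unfolding H_def p_def by measurable
  have dens: "(\<integral>\<^sup>+x. \<integral>\<^sup>+y. k x y \<partial>std_normal_distribution \<partial>std_normal_distribution)
     = (\<integral>\<^sup>+x. \<integral>\<^sup>+y. p x y * k x y \<partial>lborel \<partial>lborel)"
    if [measurable]: "case_prod k \<in> borel_measurable (borel \<Otimes>\<^sub>M borel)" for k
    by (simp add: nn_integral_density nn_integral_cmult[symmetric] p_def mult.assoc)
  \<comment> \<open>At fixed y, the new variable u = B x + b y replaces x; the second argument
    simplifies through \<open>B\<^sup>2 + b\<^sup>2 = 1\<close>.\<close>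
  have inner1: "(\<integral>\<^sup>+x. H (B * x + b * y) (b * x - B * y) \<partial>lborel)
      = ennreal (1 / B) * (\<integral>\<^sup>+u. H u (b * u / B - y / B) \<partial>lborel)" for y
  proof -
    have "B * (- b * y / B + 1 / B * u) + b * y = u" "b * (- b * y / B + 1 / B * u) - B * y = b * u / B - y / B" for u
    proof -
      show "B * (- b * y / B + 1 / B * u) + b * y = u" using assms(1) by (simp add: field_simps)
      have "b * (- b * y / B + 1 / B * u) - B * y = b * u / B - (B\<^sup>2 + b\<^sup>2) * y / B"
        using assms(1) by (simp add: field_simps power2_eq_square)
      then show "b * (- b * y / B + 1 / B * u) - B * y = b * u / B - y / B" using assms(2) by simp
    qed
    then show ?thesis
      by (subst nn_integral_real_affine[where t="- b * y / B" and c="1 / B"]) (use assms(1) in simp_all)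
  qed
  \<comment> \<open>At fixed u, the new variable v = (b u - y) / B replaces y.\<close>
  have inner2: "(\<integral>\<^sup>+y. H u (b * u / B - y / B) \<partial>lborel) = ennreal B * (\<integral>\<^sup>+v. H u v \<partial>lborel)" for u
  proof -
    have "b * u / B - (b * u + (- B) * v) / B = v" for v
      using assms(1) by (simp add: field_simps)
    then show ?thesis
      by (subst nn_integral_real_affine[where t="b * u" and c="- B"]) (use assms(1) in simp_all)
  qed
  have "(\<integral>\<^sup>+x. \<integral>\<^sup>+y. h (B * x + b * y) (b * x - B * y) \<partial>std_normal_distribution \<partial>std_normal_distribution)
    = (\<integral>\<^sup>+x. \<integral>\<^sup>+y. H (B * x + b * y) (b * x - B * y) \<partial>lborel \<partial>lborel)"
    by (simp add: dens H_def p)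
  also have "\<dots> = (\<integral>\<^sup>+y. \<integral>\<^sup>+x. H (B * x + b * y) (b * x - B * y) \<partial>lborel \<partial>lborel)"
    by (rule lborel_pair.Fubini') measurable
  also have "\<dots> = ennreal (1 / B) * (\<integral>\<^sup>+y. \<integral>\<^sup>+u. H u (b * u / B - y / B) \<partial>lborel \<partial>lborel)"
    unfolding inner1 by (rule nn_integral_cmult) measurable
  also have "(\<integral>\<^sup>+y. \<integral>\<^sup>+u. H u (b * u / B - y / B) \<partial>lborel \<partial>lborel) = (\<integral>\<^sup>+u. \<integral>\<^sup>+y. H u (b * u / B - y / B) \<partial>lborel \<partial>lborel)"
    by (rule lborel_pair.Fubini') measurable
  also have "ennreal (1 / B) * (\<integral>\<^sup>+u. \<integral>\<^sup>+y. H u (b * u / B - y / B) \<partial>lborel \<partial>lborel) = (ennreal (1 / B) * ennreal B) * (\<integral>\<^sup>+u. \<integral>\<^sup>+v. H u v \<partial>lborel \<partial>lborel)"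
    unfolding inner2 by (subst nn_integral_cmult) (measurable, simp add: mult.assoc)
  also have "\<dots> = (\<integral>\<^sup>+u. \<integral>\<^sup>+v. H u v \<partial>lborel \<partial>lborel)"
    using assms(1) by (simp add: ennreal_mult'[symmetric])
  finally show ?thesis by (simp add: dens H_def)
qed

section \<open>Splitting a normal vector into a mean and a residual\<close>

text \<open>For nonzero b this is the coordinate of x along the unit vector b / |b|. Dividing by the
  norm, not by the total weight, makes it standard normal when x is a standard normal
  vector.\<close>

definition weighted_mean :: "'i set \<Rightarrow> ('i \<Rightarrow> real) \<Rightarrow> ('i \<Rightarrow> real) \<Rightarrow> real" where
  "weighted_mean I b x = (\<Sum>i\<in>I. b i * x i) / sqrt (\<Sum>i\<in>I. (b i)\<^sup>2)"

definition residual_sum :: "'i set \<Rightarrow> ('i \<Rightarrow> real) \<Rightarrow> ('i \<Rightarrow> real) \<Rightarrow> real" where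
  "residual_sum I b x = (\<Sum>i\<in>I. (x i)\<^sup>2) - (weighted_mean I b x)\<^sup>2"

lemma weighted_mean_measurable [measurable]:
  "weighted_mean I b \<in> borel_measurable (PiM I (\<lambda>_. borel))"
  unfolding weighted_mean_def by measurable

lemma residual_sum_measurable [measurable]:
  "residual_sum I b \<in> borel_measurable (PiM I (\<lambda>_. borel))"
  unfolding residual_sum_def by measurable

text \<open>The unit vector for the enlarged index set is \<open>B / R\<close> times the old one
  plus \<open>b i / R\<close> times the new basis vector. These coefficients are the cosine and sine
  that enter the reflection in the induction below.\<close>

lemma weighted_mean_insert:
  assumes "finite I" "i \<notin> I" "B = sqrt (\<Sum>j\<in>I. (b j)\<^sup>2)" "B > 0" "R = sqrt (B\<^sup>2 + (b i)\<^sup>2)"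
  shows "weighted_mean (insert i I) b (x(i := y)) = (B / R) * weighted_mean I b x + (b i / R) * y"
proof -
  have "(\<Sum>j\<in>I. b j * (x(i := y)) j) = (\<Sum>j\<in>I. b j * x j)"
    by (rule sum.cong) (use assms in auto)
  moreover have "(\<Sum>j\<in>I. (b j)\<^sup>2) = B\<^sup>2" using assms by (simp add: sum_nonneg)
  ultimately show ?thesis
    using assms by (simp add: weighted_mean_def add_divide_distrib add.commute)
qed

lemma residual_sum_insert:
  assumes "finite I" "i \<notin> I" "B = sqrt (\<Sum>j\<in>I. (b j)\<^sup>2)" "B > 0" "R = sqrt (B\<^sup>2 + (b i)\<^sup>2)"
  shows "residual_sum (insert i I) b (x(i := y)) = residual_sum I b x + ((b i / R) * weighted_mean I b x - (B / R) * y)\<^sup>2"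
proof -
  have "(\<Sum>j\<in>I. ((x(i := y)) j)\<^sup>2) = (\<Sum>j\<in>I. (x j)\<^sup>2)"
    by (rule sum.cong) (use assms in auto)
  moreover have "(B / R)\<^sup>2 + (b i / R)\<^sup>2 = 1"
    using \<open>B > 0\<close> by (simp add: \<open>R = _\<close> power_divide add_divide_distrib[symmetric] sum_power2_eq_zero_iff)
  then have "L\<^sup>2 + y\<^sup>2 = (B / R * L + b i / R * y)\<^sup>2 + (b i / R * L - B / R * y)\<^sup>2" for L
  proof -
    have "(c * L + s * y)\<^sup>2 + (s * L - c * y)\<^sup>2 = (c\<^sup>2 + s\<^sup>2) * (L\<^sup>2 + y\<^sup>2)" for c s :: real
      by (simp add: power2_eq_square algebra_simps)
    from this[of "B / R" "b i / R"] \<open>(B / R)\<^sup>2 + (b i / R)\<^sup>2 = 1\<close> show ?thesis by simp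
  qed
  from this[of "weighted_mean I b x"] have "(weighted_mean I b x)\<^sup>2 + y\<^sup>2 = (B / R * weighted_mean I b x + b i / R * y)\<^sup>2 + (b i / R * weighted_mean I b x - B / R * y)\<^sup>2" .
  ultimately show ?thesis
    using assms(1,2) by (simp add: residual_sum_def weighted_mean_insert[OF assms])
qed

lemma PiM_std_normal_sets [measurable_cong]: "sets (PiM I (\<lambda>_. std_normal_distribution)) = sets (PiM I (\<lambda>_. borel))"
  by (rule sets_PiM_cong) auto

text \<open>The induction works because adding a coordinate \<open>y\<close>
  rotates the pair (old mean, \<open>y\<close>) into (new mean, \<open>v\<close>), and \<open>v\<^sup>2\<close> is the increment of the residual sum.\<close>

lemma nn_integral_residual_sum_weighted_mean:
  assumes "finite I" "I \<noteq> {}" "\<And>i. i \<in> I \<Longrightarrow> b i > 0"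
    and "case_prod h \<in> borel_measurable (borel \<Otimes>\<^sub>M borel)"
  shows "(\<integral>\<^sup>+x. h (residual_sum I b x) (weighted_mean I b x) \<partial>PiM I (\<lambda>_. std_normal_distribution))
    = (\<integral>\<^sup>+q. \<integral>\<^sup>+l. h q l \<partial>std_normal_distribution \<partial>sum_squares_law (card I - 1))"
  using assms
proof (induction I arbitrary: h rule: finite_ne_induct)
  case (singleton i)
  note [measurable] = singleton.prems(2)
  have "prob_space std_normal_distribution" by (rule prob_space_std_normal)
  then interpret product_prob_space "\<lambda>_. std_normal_distribution" "{i}"
    by (intro product_prob_spaceI)
  \<comment> \<open>One coordinate leaves nothing orthogonal to b, which matches the point mass
    \<open>sum_squares_law 0\<close>; positivity of \<open>b i\<close> fixes the sign of the
    mean.\<close>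
  have [simp]: "residual_sum {i} b x = 0" "weighted_mean {i} b x = x i" for x
    using singleton.prems(1)[of i] by (auto simp: residual_sum_def weighted_mean_def)
  have "(\<integral>\<^sup>+x. h 0 (x i) \<partial>PiM {i} (\<lambda>_. std_normal_distribution)) = (\<integral>\<^sup>+l. h 0 l \<partial>std_normal_distribution)"
    by (rule product_nn_integral_singleton) simp
  moreover have "(\<integral>\<^sup>+q. \<integral>\<^sup>+l. h q l \<partial>std_normal_distribution \<partial>return borel 0) = (\<integral>\<^sup>+l. h 0 l \<partial>std_normal_distribution)"
    by (rule nn_integral_return) (simp, measurable)
  ultimately show ?case by simp
next
  case (insert i I)
  note [measurable] = insert.prems(2)
  interpret N: prob_space std_normal_distribution by (rule prob_space_std_normal)
  interpret product_prob_space "\<lambda>_. std_normal_distribution" "insert i I"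
    by (intro product_prob_spaceI prob_space_std_normal)
  interpret K: prob_space "sum_squares_law (card I - 1)" by (rule prob_space_sum_squares_law)
  define B where "B = sqrt (\<Sum>j\<in>I. (b j)\<^sup>2)"
  have B: "B > 0" unfolding B_def real_sqrt_gt_0_iff using insert by (intro sum_pos) (simp_all add: less_imp_neq[THEN not_sym])
  define R where "R = sqrt (B\<^sup>2 + (b i)\<^sup>2)"
  have R: "R > 0" unfolding R_def using B by (simp add: add_pos_nonneg)
  define c s where "c = B / R" and "s = b i / R"
  have cs: "c > 0" "c\<^sup>2 + s\<^sup>2 = 1"
    using B R by (auto simp: c_def s_def power_divide add_divide_distrib[symmetric]) (simp add: R_def)
  note ins = weighted_mean_insert[OF insert.hyps(1,3) B_def B R_def] residual_sum_insert[OF insert.hyps(1,3) B_def B R_def]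
  \<comment> \<open>The induction runs over arbitrary h so that its hypothesis applies to this k, in
    which the new coordinate is already integrated out.\<close>
  define k where "k q l = (\<integral>\<^sup>+y. h (q + (s * l - c * y)\<^sup>2) (c * l + s * y) \<partial>std_normal_distribution)" for q l
  have [measurable]: "case_prod k \<in> borel_measurable (borel \<Otimes>\<^sub>M borel)"
    unfolding k_def by measurable
  have "(\<integral>\<^sup>+x. h (residual_sum (insert i I) b x) (weighted_mean (insert i I) b x) \<partial>PiM (insert i I) (\<lambda>_. std_normal_distribution))
    = (\<integral>\<^sup>+x. \<integral>\<^sup>+y. h (residual_sum (insert i I) b (x(i := y))) (weighted_mean (insert i I) b (x(i := y))) \<partial>std_normal_distribution \<partial>PiM I (\<lambda>_. std_normal_distribution))"
    by (rule product_nn_integral_insert) (use insert in auto)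
  also have "\<dots> = (\<integral>\<^sup>+x. k (residual_sum I b x) (weighted_mean I b x) \<partial>PiM I (\<lambda>_. std_normal_distribution))"
    unfolding ins k_def c_def s_def ..
  also have "\<dots> = (\<integral>\<^sup>+q. \<integral>\<^sup>+l. k q l \<partial>std_normal_distribution \<partial>sum_squares_law (card I - 1))"
    by (rule insert.IH) (use insert.prems in auto)
  also have "\<dots> = (\<integral>\<^sup>+q. \<integral>\<^sup>+u. \<integral>\<^sup>+v. h (q + v\<^sup>2) u \<partial>std_normal_distribution \<partial>std_normal_distribution \<partial>sum_squares_law (card I - 1))"
    unfolding k_def using nn_integral_std_normal_reflection[OF cs, of "\<lambda>u v. h (q + v\<^sup>2) u" for q]
    by (simp cong: nn_integral_cong)
  \<comment> \<open>Moving v outwards places v^2 next to the old residual q, where the two convolve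
    to the next law, while the new mean u remains an independent standard normal.\<close>
  also have "\<dots> = (\<integral>\<^sup>+q. \<integral>\<^sup>+v. \<integral>\<^sup>+u. h (q + v\<^sup>2) u \<partial>std_normal_distribution \<partial>std_normal_distribution \<partial>sum_squares_law (card I - 1))"
  proof (rule nn_integral_cong)
    fix q
    interpret pair_sigma_finite std_normal_distribution std_normal_distribution ..
    show "(\<integral>\<^sup>+u. \<integral>\<^sup>+v. h (q + v\<^sup>2) u \<partial>std_normal_distribution \<partial>std_normal_distribution)
       = (\<integral>\<^sup>+v. \<integral>\<^sup>+u. h (q + v\<^sup>2) u \<partial>std_normal_distribution \<partial>std_normal_distribution)"
      by (rule Fubini'[symmetric]) measurable
  qed
  also have "\<dots> = (\<integral>\<^sup>+q. \<integral>\<^sup>+r. \<integral>\<^sup>+u. h (q + r) u \<partial>std_normal_distribution \<partial>distr std_normal_distribution borel (\<lambda>x. x\<^sup>2) \<partial>sum_squares_law (card I - 1))"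
    by (simp add: nn_integral_distr)
  also have "\<dots> = (\<integral>\<^sup>+q. \<integral>\<^sup>+u. h q u \<partial>std_normal_distribution \<partial>sum_squares_law (Suc (card I - 1)))"
    unfolding sum_squares_law.simps
    by (rule nn_integral_convolution[symmetric])
       (use K.finite_measure_axioms prob_space.finite_measure[OF prob_space_square_std_normal] in \<open>(measurable; simp)+\<close>)
  also have "Suc (card I - 1) = card (insert i I) - 1"
    using insert.hyps by (simp add: card_gt_0_iff)
  finally show ?case .
qed

text \<open>This is the marginal of the joint statement above, the mean being needed only to carry
  the induction. Two indices are the minimum, because a single one gives the residual 0, which has
  no density.\<close>

lemma distr_residual_sum:
  assumes "finite I" "card I \<ge> 2" "\<And>i. i \<in> I \<Longrightarrow> b i > 0"
  shows "distr (PiM I (\<lambda>_. std_normal_distribution)) borel (residual_sum I b) = chi_squared (card I - 1)"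
proof (rule measure_eqI)
  fix A assume "A \<in> sets (distr (PiM I (\<lambda>_. std_normal_distribution)) borel (residual_sum I b))"
  then have [measurable]: "A \<in> sets borel" by simp
  interpret N: prob_space std_normal_distribution by (rule prob_space_std_normal)
  have "emeasure (distr (PiM I (\<lambda>_. std_normal_distribution)) borel (residual_sum I b)) A
     = (\<integral>\<^sup>+x. indicator A (residual_sum I b x) \<partial>PiM I (\<lambda>_. std_normal_distribution))"
    by (subst nn_integral_indicator[symmetric], simp, subst nn_integral_distr) auto
  also have "\<dots> = (\<integral>\<^sup>+q. \<integral>\<^sup>+l. indicator A q \<partial>std_normal_distribution \<partial>sum_squares_law (card I - 1))"
    by (rule nn_integral_residual_sum_weighted_mean) (use assms in auto)
  also have "\<dots> = emeasure (sum_squares_law (card I - 1)) A"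
    by (simp add: N.emeasure_space_1[simplified])
  finally show "emeasure (distr (PiM I (\<lambda>_. std_normal_distribution)) borel (residual_sum I b)) A = emeasure (chi_squared (card I - 1)) A"
    using assms(2) by (simp add: sum_squares_law_eq_chi_squared)
qed (simp add: chi_squared_def)

subsection \<open>A strong law of large numbers\<close>

context prob_space begin

text \<open>Termwise integration shows that the series of squares has finite expectation. It
  therefore converges almost surely, and the terms of a convergent series tend to 0.\<close>

lemma AE_tendsto_zero_of_summable_second_moment:
  fixes X :: "nat \<Rightarrow> 'a \<Rightarrow> real"
  assumes [measurable]: "\<And>n. X n \<in> borel_measurable M"
    and int: "\<And>n. integrable M (\<lambda>\<omega>. (X n \<omega>)\<^sup>2)"
    and le: "\<And>n. expectation (\<lambda>\<omega>. (X n \<omega>)\<^sup>2) \<le> c n" and "summable c"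
  shows "AE \<omega> in M. (\<lambda>n. X n \<omega>) \<longlonglongrightarrow> 0"
proof -
  have c: "c n \<ge> 0" for n using order_trans[OF _ le[of n]] by simp
  have "(\<integral>\<^sup>+\<omega>. (\<Sum>n. ennreal ((X n \<omega>)\<^sup>2)) \<partial>M) = (\<Sum>n. \<integral>\<^sup>+\<omega>. ennreal ((X n \<omega>)\<^sup>2) \<partial>M)"
    by (rule nn_integral_suminf) simp
  also have "\<dots> = (\<Sum>n. ennreal (expectation (\<lambda>\<omega>. (X n \<omega>)\<^sup>2)))"
    by (subst nn_integral_eq_integral[OF int]) simp_all
  also have "\<dots> \<le> (\<Sum>n. ennreal (c n))"
    by (intro suminf_le ennreal_leI le) auto
  also have "\<dots> = ennreal (\<Sum>n. c n)"
    by (rule suminf_ennreal2[OF c \<open>summable c\<close>])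
  finally have "(\<integral>\<^sup>+\<omega>. (\<Sum>n. ennreal ((X n \<omega>)\<^sup>2)) \<partial>M) \<noteq> \<infinity>"
    by (auto simp: top_unique)
  then have "AE \<omega> in M. (\<Sum>n. ennreal ((X n \<omega>)\<^sup>2)) \<noteq> \<infinity>"
    by (intro nn_integral_noteq_infinite) auto
  then show ?thesis
  proof eventually_elim
    case (elim \<omega>)
    then have "summable (\<lambda>n. (X n \<omega>)\<^sup>2)"
      by (intro summable_suminf_not_top) auto
    then have "(\<lambda>n. (X n \<omega>)\<^sup>2) \<longlonglongrightarrow> 0" by (rule summable_LIMSEQ_zero)
    then have "(\<lambda>n. sqrt ((X n \<omega>)\<^sup>2)) \<longlonglongrightarrow> sqrt 0" by (rule tendsto_real_sqrt)
    then show ?case by (simp add: tendsto_rabs_zero_iff)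
  qed
qed

text \<open>Off-diagonal products have mean zero by independence. The index set is an arbitrary
  finite set because both initial segments and gaps between squares are needed.\<close>

lemma expectation_square_sum_indep:
  fixes Y :: "nat \<Rightarrow> 'a \<Rightarrow> real" and v :: real
  assumes ind: "indep_vars (\<lambda>_. borel) Y UNIV"
    and sq: "\<And>k. integrable M (\<lambda>\<omega>. (Y k \<omega>)\<^sup>2)"
    and mean: "\<And>k. expectation (Y k) = 0"
    and var: "\<And>k. expectation (\<lambda>\<omega>. (Y k \<omega>)\<^sup>2) = v"
    and "finite A"
  shows "integrable M (\<lambda>\<omega>. (\<Sum>k\<in>A. Y k \<omega>)\<^sup>2)" "expectation (\<lambda>\<omega>. (\<Sum>k\<in>A. Y k \<omega>)\<^sup>2) = card A * v"
proof -
  have [measurable]: "Y k \<in> borel_measurable M" for k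
    using ind by (auto simp: indep_vars_def)
  have int: "integrable M (Y k)" for k
    by (rule square_integrable_imp_integrable) (use sq in auto)
  have pr: "integrable M (\<lambda>\<omega>. Y j \<omega> * Y k \<omega>) \<and> expectation (\<lambda>\<omega>. Y j \<omega> * Y k \<omega>) = (if j = k then v else 0)" for j k
  proof (cases "j = k")
    case True
    then show ?thesis using sq[of k] var[of k] by (simp add: power2_eq_square)
  next
    case False
    have iv: "indep_vars (\<lambda>_. borel) Y {j, k}" by (rule indep_vars_subset[OF ind]) simp
    show ?thesis
      using indep_vars_integrable[OF _ iv int] indep_vars_lebesgue_integral[OF _ iv int] mean False by simp
  qed
  have eq: "(\<Sum>k\<in>A. Y k \<omega>)\<^sup>2 = (\<Sum>j\<in>A. \<Sum>k\<in>A. Y j \<omega> * Y k \<omega>)" for \<omega>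
    by (simp add: power2_eq_square sum_product)
  show "integrable M (\<lambda>\<omega>. (\<Sum>k\<in>A. Y k \<omega>)\<^sup>2)" unfolding eq using pr by auto
  have "expectation (\<lambda>\<omega>. (\<Sum>k\<in>A. Y k \<omega>)\<^sup>2) = (\<Sum>j\<in>A. \<Sum>k\<in>A. if j = k then v else 0)"
    unfolding eq using pr by (subst Bochner_Integration.integral_sum | simp)+
  then show "expectation (\<lambda>\<omega>. (\<Sum>k\<in>A. Y k \<omega>)\<^sup>2) = card A * v" using \<open>finite A\<close> by simp
qed

text \<open>With finite variance, the partial sums at squares converge along a summable second-moment
  series, and so do the gaps \<open>S n - S (k\<^sup>2)\<close> with \<open>k\<^sup>2 \<le> n < (k + 1)\<^sup>2\<close>, whose variance is of order \<open>sqrt n\<close>.\<close>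

lemma strong_law_zero_mean:
  fixes Y :: "nat \<Rightarrow> 'a \<Rightarrow> real" and v :: real
  assumes ind: "indep_vars (\<lambda>_. borel) Y UNIV"
    and sq: "\<And>k. integrable M (\<lambda>\<omega>. (Y k \<omega>)\<^sup>2)"
    and mean: "\<And>k. expectation (Y k) = 0"
    and var: "\<And>k. expectation (\<lambda>\<omega>. (Y k \<omega>)\<^sup>2) = v"
  shows "AE \<omega> in M. (\<lambda>n. (\<Sum>k<n. Y k \<omega>) / n) \<longlonglongrightarrow> 0"
proof -
  have [measurable]: "Y k \<in> borel_measurable M" for k
    using ind by (auto simp: indep_vars_def)
  have "expectation (\<lambda>\<omega>. (Y 0 \<omega>)\<^sup>2) \<ge> 0" by simp
  then have v: "v \<ge> 0" using var by simp
  note moments = expectation_square_sum_indep[OF ind sq mean var]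
  \<comment> \<open>\<open>(r n)\<^sup>2\<close> is the largest square not exceeding n, and
    factoring n - (r n)^2 as a difference of squares bounds the gap by 2 sqrt n.\<close>
  define r where "r n = nat \<lfloor>sqrt (real n)\<rfloor>" for n
  have r_le: "real (r n) \<le> sqrt n" and r_gt: "sqrt n < real (r n) + 1" for n
    unfolding r_def by (simp_all add: of_nat_nat)
  have r2: "(r n)\<^sup>2 \<le> n" for n
  proof -
    have "(real (r n))\<^sup>2 \<le> (sqrt n)\<^sup>2" using r_le by (intro power_mono) auto
    then have "real ((r n)\<^sup>2) \<le> real n" by simp
    then show ?thesis by (simp only: of_nat_le_iff)
  qed
  have gap: "real n - real ((r n)\<^sup>2) \<le> 2 * sqrt n" for n
  proof -
    have "(sqrt n - real (r n)) * (sqrt n + real (r n)) \<le> 1 * (2 * sqrt n)"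
      using r_le[of n] r_gt[of n] by (intro mult_mono) auto
    then show ?thesis by (simp add: algebra_simps power2_eq_square)
  qed
  have "AE \<omega> in M. (\<lambda>n. (\<Sum>k\<in>{..<(Suc n)\<^sup>2}. Y k \<omega>) / real ((Suc n)\<^sup>2)) \<longlonglongrightarrow> 0"
  proof (rule AE_tendsto_zero_of_summable_second_moment)
    fix n
    show "(\<lambda>\<omega>. (\<Sum>k\<in>{..<(Suc n)\<^sup>2}. Y k \<omega>) / real ((Suc n)\<^sup>2)) \<in> borel_measurable M" by measurable
    show "integrable M (\<lambda>\<omega>. ((\<Sum>k\<in>{..<(Suc n)\<^sup>2}. Y k \<omega>) / real ((Suc n)\<^sup>2))\<^sup>2)"
      unfolding power_divide by (intro integrable_divide moments) auto
    have "expectation (\<lambda>\<omega>. ((\<Sum>k\<in>{..<(Suc n)\<^sup>2}. Y k \<omega>) / real ((Suc n)\<^sup>2))\<^sup>2) = real ((Suc n)\<^sup>2) * v / (real ((Suc n)\<^sup>2))\<^sup>2"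
      unfolding power_divide by (subst integral_divide_zero, subst moments(2)) simp_all
    also have "\<dots> = v * inverse ((real (Suc n))\<^sup>2)"
    proof -
      have "y * v / y\<^sup>2 = v * inverse y" if "y \<noteq> 0" for y :: real
        using that by (simp add: field_simps power2_eq_square)
      from this[of "real ((Suc n)\<^sup>2)"] show ?thesis by (simp only: of_nat_power) simp
    qed
    finally show "expectation (\<lambda>\<omega>. ((\<Sum>k\<in>{..<(Suc n)\<^sup>2}. Y k \<omega>) / real ((Suc n)\<^sup>2))\<^sup>2) \<le> v * inverse ((real (Suc n))\<^sup>2)"
      by simp
    have "summable (\<lambda>n. inverse (real n ^ 2))" using inverse_power_summable[of 2] by simp
    then have "summable (\<lambda>n. inverse ((real (Suc n))\<^sup>2))" by (subst summable_Suc_iff)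
    then show "summable (\<lambda>n. v * inverse ((real (Suc n))\<^sup>2))" by (rule summable_mult)
  qed
  moreover have "AE \<omega> in M. (\<lambda>n. (\<Sum>k\<in>{(r n)\<^sup>2..<n}. Y k \<omega>) / real n) \<longlonglongrightarrow> 0"
  proof (rule AE_tendsto_zero_of_summable_second_moment)
    fix n
    show "(\<lambda>\<omega>. (\<Sum>k\<in>{(r n)\<^sup>2..<n}. Y k \<omega>) / real n) \<in> borel_measurable M" by measurable
    show "integrable M (\<lambda>\<omega>. ((\<Sum>k\<in>{(r n)\<^sup>2..<n}. Y k \<omega>) / real n)\<^sup>2)"
      unfolding power_divide by (intro integrable_divide moments) auto
    have "expectation (\<lambda>\<omega>. ((\<Sum>k\<in>{(r n)\<^sup>2..<n}. Y k \<omega>) / real n)\<^sup>2) = real (n - (r n)\<^sup>2) * v / (real n)\<^sup>2"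
      unfolding power_divide by (subst integral_divide_zero, subst moments(2)) simp_all
    \<comment> \<open>A gap of order sqrt n divided by n^2 leaves n^(-3/2), which is summable; along
      the squares themselves the corresponding bound is 1 / n^2.\<close>
    also have "\<dots> \<le> (2 * sqrt n) * v / (real n)\<^sup>2"
      using gap[of n] r2[of n] v by (intro divide_right_mono mult_right_mono) (auto simp: of_nat_diff)
    also have "\<dots> = 2 * v * (real n powr (- (3 / 2)))"
    proof (cases "n = 0")
      case False
      have "real n powr (- (3 / 2)) * (real n)\<^sup>2 = real n powr (- (3 / 2)) * real n powr 2" using False by simp
      also have "\<dots> = real n powr (- (3 / 2) + 2)" by (rule powr_add[symmetric])
      also have "\<dots> = sqrt n" by (simp add: powr_half_sqrt)
      finally show ?thesis using False by (simp add: field_simps)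
    qed simp
    finally show "expectation (\<lambda>\<omega>. ((\<Sum>k\<in>{(r n)\<^sup>2..<n}. Y k \<omega>) / real n)\<^sup>2) \<le> 2 * v * (real n powr (- (3 / 2)))" .
    show "summable (\<lambda>n. 2 * v * (real n powr (- (3 / 2))))"
      by (intro summable_mult) (simp add: summable_real_powr_iff)
  qed
  ultimately show ?thesis
  proof eventually_elim
    case (elim \<omega>)
    define a where "a n = (\<Sum>k\<in>{..<n\<^sup>2}. Y k \<omega>) / real (n\<^sup>2)" for n
    have "a \<longlonglongrightarrow> 0" using elim(1) unfolding a_def by (subst (asm) filterlim_sequentially_Suc)
    moreover have "filterlim r at_top sequentially"
      unfolding r_def by (intro filterlim_compose[OF filterlim_nat_sequentially] filterlim_compose[OF filterlim_floor_sequentially]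
          filterlim_compose[OF sqrt_at_top] filterlim_real_sequentially)
    ultimately have ar: "(\<lambda>n. a (r n)) \<longlonglongrightarrow> 0" by (rule filterlim_compose)
    \<comment> \<open>The factor (r n)^2 / n converts the average over the first (r n)^2 terms to
      the divisor n. It lies in [0, 1], so the null sequence absorbs it.\<close>
    have "(\<lambda>n. a (r n) * (real ((r n)\<^sup>2) / real n)) \<longlonglongrightarrow> 0"
    proof (rule lim_null_mult_right_bounded[OF ar])
      have "\<bar>real ((r n)\<^sup>2) / real n\<bar> \<le> 1" for n using r2[of n] by (auto simp: divide_le_eq_1 simp del: of_nat_power)
      then show "\<forall>\<^sub>F n in sequentially. norm (real ((r n)\<^sup>2) / real n) \<le> 1" by simp
    qed
    then have "(\<lambda>n. a (r n) * (real ((r n)\<^sup>2) / real n) + (\<Sum>k\<in>{(r n)\<^sup>2..<n}. Y k \<omega>) / real n) \<longlonglongrightarrow> 0 + 0"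
      using elim(2) by (rule tendsto_add)
    moreover have "a (r n) * (real ((r n)\<^sup>2) / real n) + (\<Sum>k\<in>{(r n)\<^sup>2..<n}. Y k \<omega>) / real n = (\<Sum>k<n. Y k \<omega>) / n" for n
    proof -
      have "{..<n} = {..<(r n)\<^sup>2} \<union> {(r n)\<^sup>2..<n}" using r2[of n] by auto
      then have "(\<Sum>k<n. Y k \<omega>) = (\<Sum>k\<in>{..<(r n)\<^sup>2}. Y k \<omega>) + (\<Sum>k\<in>{(r n)\<^sup>2..<n}. Y k \<omega>)"
        by (simp add: sum.union_disjoint ivl_disj_int)
      then show ?thesis by (cases "r n = 0") (auto simp: a_def add_divide_distrib)
    qed
    ultimately show ?case by simp
  qed
qed


text \<open>Bridges two numberings: claims are counted from 1, whereas the strong law and the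
  central limit theorem sum from 0.\<close>

lemma indep_vars_Suc:
  assumes "indep_vars (\<lambda>_. S) X {1::nat..}"
  shows "indep_vars (\<lambda>_. S) (\<lambda>k. X (Suc k)) UNIV"
  unfolding indep_vars_def2
proof (intro conjI ballI indep_setsI)
  fix k
  show rv: "random_variable S (X (Suc k))" using assms by (auto simp: indep_vars_def2)
  show "{X (Suc k) -` A \<inter> space M |A. A \<in> sets S} \<subseteq> events"
    using rv by (auto intro: measurable_sets)
next
  fix A and J :: "nat set"
  assume J: "J \<noteq> {}" "finite J" and A: "\<forall>j\<in>J. A j \<in> {X (Suc j) -` A \<inter> space M |A. A \<in> sets S}"
  have "indep_sets (\<lambda>k. {X k -` A \<inter> space M |A. A \<in> sets S}) {1..}"
    using assms by (simp add: indep_vars_def2)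
  then have "prob (\<Inter>j\<in>Suc ` J. A (j - 1)) = (\<Prod>j\<in>Suc ` J. prob (A (j - 1)))"
    by (rule indep_setsD) (use J A in auto)
  then show "prob (\<Inter>j\<in>J. A j) = (\<Prod>j\<in>J. prob (A j))"
    by (simp add: prod.reindex)
qed

lemma strong_law_square_integrable:
  fixes U :: "nat \<Rightarrow> 'a \<Rightarrow> real"
  assumes ind: "indep_vars (\<lambda>_. borel) U {1..}"
    and sq: "\<And>k. k \<ge> 1 \<Longrightarrow> integrable M (\<lambda>\<omega>. (U k \<omega>)\<^sup>2)"
    and mean: "\<And>k. k \<ge> 1 \<Longrightarrow> expectation (U k) = m"
    and sqmean: "\<And>k. k \<ge> 1 \<Longrightarrow> expectation (\<lambda>\<omega>. (U k \<omega>)\<^sup>2) = s"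
  shows "AE \<omega> in M. (\<lambda>n. (\<Sum>k\<in>{1..n}. U k \<omega>) / n) \<longlonglongrightarrow> m"
proof -
  have [measurable]: "U (Suc k) \<in> borel_measurable M" for k
    using ind by (auto simp: indep_vars_def)
  have int: "integrable M (U (Suc k))" for k
    by (rule square_integrable_imp_integrable) (use sq in auto)
  define Y where "Y k \<omega> = U (Suc k) \<omega> - m" for k \<omega>
  have Y2: "(Y k \<omega>)\<^sup>2 = (U (Suc k) \<omega>)\<^sup>2 - 2 * m * U (Suc k) \<omega> + m\<^sup>2" for k \<omega>
    by (simp add: Y_def power2_eq_square algebra_simps)
  have "AE \<omega> in M. (\<lambda>n. (\<Sum>k<n. Y k \<omega>) / n) \<longlonglongrightarrow> 0"
  proof (rule strong_law_zero_mean)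
    show "indep_vars (\<lambda>_. borel) Y UNIV"
      unfolding Y_def by (rule indep_vars_compose2[OF indep_vars_Suc[OF ind], of "\<lambda>_ x. x - m"]) simp
    show "integrable M (\<lambda>\<omega>. (Y k \<omega>)\<^sup>2)" for k unfolding Y2 using int sq by simp
    show "expectation (Y k) = 0" for k unfolding Y_def using int mean by (simp add: prob_space)
    show "expectation (\<lambda>\<omega>. (Y k \<omega>)\<^sup>2) = s - 2 * m * m + m\<^sup>2" for k
      unfolding Y2 using int sq mean sqmean by (simp add: prob_space)
  qed
  then show ?thesis
  proof eventually_elim
    case (elim \<omega>)
    have "(\<Sum>k<n. Y k \<omega>) / n + m = (\<Sum>k\<in>{1..n}. U k \<omega>) / n" if "n > 0" for n
    proof -
      have "(\<Sum>k\<in>{1..n}. U k \<omega>) = (\<Sum>k<n. U (Suc k) \<omega>)"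
        using sum.atLeast1_atMost_eq[of "\<lambda>k. U k \<omega>" n] by simp
      then show ?thesis using that by (simp add: Y_def sum_subtractf field_simps)
    qed
    then have "\<forall>\<^sub>F n in sequentially. (\<Sum>k<n. Y k \<omega>) / n + m = (\<Sum>k\<in>{1..n}. U k \<omega>) / n"
      using eventually_gt_at_top[of 0] by (rule eventually_mono[rotated])
    moreover have "(\<lambda>n. (\<Sum>k<n. Y k \<omega>) / n + m) \<longlonglongrightarrow> 0 + m" using elim by (intro tendsto_intros)
    ultimately show ?case by (simp add: tendsto_cong)
  qed
qed

subsection \<open>Weak convergence\<close>

text \<open>Splitting on the value of the index and using independence turns the distribution
  function at x into the expectation of \<open>c (N n)\<close>, where \<open>c m\<close> is the
  distribution function for the fixed index m. On almost every path the index tends to infinity, so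
  dominated convergence yields the limit; joint laws of different \<open>G m\<close> never
  enter.\<close>

lemma weak_conv_random_index:
  fixes G :: "nat \<Rightarrow> 'a \<Rightarrow> real" and N :: "nat \<Rightarrow> 'a \<Rightarrow> nat"
  assumes [measurable]: "\<And>m. G m \<in> borel_measurable M" "\<And>n. N n \<in> measurable M (count_space UNIV)"
    and ind: "\<And>n m x. prob {\<omega>\<in>space M. N n \<omega> = m \<and> G m \<omega> \<le> x} = prob {\<omega>\<in>space M. N n \<omega> = m} * prob {\<omega>\<in>space M. G m \<omega> \<le> x}"
    and conv: "weak_conv_m (\<lambda>m. distr M borel (G m)) \<mu>"
    and lim: "AE \<omega> in M. filterlim (\<lambda>n. N n \<omega>) at_top sequentially"
  shows "weak_conv_m (\<lambda>n. distr M borel (\<lambda>\<omega>. G (N n \<omega>) \<omega>)) \<mu>"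
  unfolding weak_conv_m_def weak_conv_def
proof (intro allI impI)
  fix x assume x: "isCont (cdf \<mu>) x"
  define c where "c m = prob {\<omega>\<in>space M. G m \<omega> \<le> x}" for m
  have cdf_distr: "cdf (distr M borel X) x = prob {\<omega>\<in>space M. X \<omega> \<le> x}" if [measurable]: "X \<in> borel_measurable M" for X
    unfolding cdf_def by (subst measure_distr) (auto intro!: arg_cong[of _ _ prob])
  have c: "c \<longlonglongrightarrow> cdf \<mu> x"
  proof -
    have "cdf (distr M borel (G m)) x = c m" for m by (simp add: cdf_distr c_def)
    then show ?thesis using conv x by (auto simp: weak_conv_m_def weak_conv_def)
  qed
  have eq: "cdf (distr M borel (\<lambda>\<omega>. G (N n \<omega>) \<omega>)) x = expectation (\<lambda>\<omega>. c (N n \<omega>))" for n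
  proof -
    have "emeasure M {\<omega>\<in>space M. G (N n \<omega>) \<omega> \<le> x} = emeasure M (\<Union>m. {\<omega>\<in>space M. N n \<omega> = m \<and> G m \<omega> \<le> x})"
      by (rule arg_cong[of _ _ "emeasure M"]) auto
    also have "\<dots> = (\<Sum>m. emeasure M {\<omega>\<in>space M. N n \<omega> = m \<and> G m \<omega> \<le> x})"
      by (rule suminf_emeasure[symmetric]) (auto simp: disjoint_family_on_def)
    also have "\<dots> = (\<Sum>m. \<integral>\<^sup>+\<omega>. ennreal (c m) * indicator {\<omega>\<in>space M. N n \<omega> = m} \<omega> \<partial>M)"
      by (subst nn_integral_cmult_indicator) (simp_all add: emeasure_eq_measure ind c_def ennreal_mult' mult.commute)
    also have "\<dots> = (\<integral>\<^sup>+\<omega>. (\<Sum>m. ennreal (c m) * indicator {\<omega>\<in>space M. N n \<omega> = m} \<omega>) \<partial>M)"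
      by (rule nn_integral_suminf[symmetric]) simp
    also have "\<dots> = (\<integral>\<^sup>+\<omega>. ennreal (c (N n \<omega>)) \<partial>M)"
    proof (rule nn_integral_cong)
      fix \<omega> assume "\<omega> \<in> space M"
      then have "(\<Sum>m. ennreal (c m) * indicator {\<omega>\<in>space M. N n \<omega> = m} \<omega>) = (\<Sum>m\<in>{N n \<omega>}. ennreal (c m) * indicator {\<omega>\<in>space M. N n \<omega> = m} \<omega>)"
        by (intro suminf_finite) auto
      then show "(\<Sum>m. ennreal (c m) * indicator {\<omega>\<in>space M. N n \<omega> = m} \<omega>) = ennreal (c (N n \<omega>))"
        using \<open>\<omega> \<in> space M\<close> by simp
    qed
    also have "\<dots> = ennreal (expectation (\<lambda>\<omega>. c (N n \<omega>)))"
      by (rule nn_integral_eq_integral) (auto intro!: integrable_const_bound[of _ 1] simp: c_def)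
    finally show ?thesis
      by (subst cdf_distr) (auto simp: emeasure_eq_measure c_def)
  qed
  have "(\<lambda>n. expectation (\<lambda>\<omega>. c (N n \<omega>))) \<longlonglongrightarrow> expectation (\<lambda>\<omega>. cdf \<mu> x)"
  proof (rule integral_dominated_convergence)
    show "AE \<omega> in M. (\<lambda>n. c (N n \<omega>)) \<longlonglongrightarrow> cdf \<mu> x"
      using lim by eventually_elim (rule filterlim_compose[OF c])
    show "AE \<omega> in M. norm (c (N n \<omega>)) \<le> 1" for n by (simp add: c_def)
  qed auto
  then show "(\<lambda>n. cdf (distr M borel (\<lambda>\<omega>. G (N n \<omega>) \<omega>)) x) \<longlonglongrightarrow> cdf \<mu> x"
    by (simp add: eq prob_space)
qed

section \<open>Perturbations that vanish in probability\<close>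

text \<open>The function y -> exp(i t y) is Lipschitz with constant |t| and has modulus 1. Hence the
  two characteristic functions differ by at most |t| e plus twice the probability that the variables
  are more than e apart, and Levy continuity finishes.\<close>

lemma weak_conv_Slutsky:
  fixes X Y :: "nat \<Rightarrow> 'a \<Rightarrow> real"
  assumes [measurable]: "\<And>n. X n \<in> borel_measurable M" "\<And>n. Y n \<in> borel_measurable M"
    and \<mu>: "real_distribution \<mu>" and conv: "weak_conv_m (\<lambda>n. distr M borel (X n)) \<mu>"
    and diff: "\<And>e. e > 0 \<Longrightarrow> (\<lambda>n. prob {\<omega>\<in>space M. \<bar>Y n \<omega> - X n \<omega>\<bar> > e}) \<longlonglongrightarrow> 0"
  shows "weak_conv_m (\<lambda>n. distr M borel (Y n)) \<mu>"
proof (rule levy_continuity)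
  fix t
  have X: "(\<lambda>n. char (distr M borel (X n)) t) \<longlonglongrightarrow> char \<mu> t"
    by (rule levy_continuity1[OF _ \<mu> conv]) simp
  have char_distr: "char (distr M borel V) t = (CLINT \<omega>|M. iexp (t * V \<omega>))" if [measurable]: "V \<in> borel_measurable M" for V
    unfolding char_def by (subst integral_distr) auto
  have "(\<lambda>n. char (distr M borel (Y n)) t - char (distr M borel (X n)) t) \<longlonglongrightarrow> 0"
  proof (rule LIMSEQ_I)
    fix r :: real assume "r > 0"
    \<comment> \<open>The summand 1 covers t = 0. The Lipschitz part then costs at most r / 2, and
      twice the probability bound r / 4 supplies the other half.\<close>
    define e where "e = r / (2 * (\<bar>t\<bar> + 1))"
    have e: "e > 0" using \<open>r > 0\<close> by (simp add: e_def)
    have te: "\<bar>t\<bar> * e \<le> r / 2" using \<open>r > 0\<close> by (simp add: e_def field_simps)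
    have "\<forall>\<^sub>F n in sequentially. prob {\<omega>\<in>space M. \<bar>Y n \<omega> - X n \<omega>\<bar> > e} < r / 4"
      using \<open>r > 0\<close> by (intro order_tendstoD(2)[OF diff[OF e]]) auto
    then obtain n0 where n0: "\<And>n. n \<ge> n0 \<Longrightarrow> prob {\<omega>\<in>space M. \<bar>Y n \<omega> - X n \<omega>\<bar> > e} < r / 4"
      by (auto simp: eventually_sequentially)
    have "norm (char (distr M borel (Y n)) t - char (distr M borel (X n)) t) < r" if "n \<ge> n0" for n
    proof -
      have int: "complex_integrable M (\<lambda>\<omega>. iexp (t * V \<omega>))" if [measurable]: "V \<in> borel_measurable M" for V
        by (rule integrable_const_bound[of _ 1]) auto
      have pt: "norm (iexp (t * y) - iexp (t * x)) \<le> \<bar>t\<bar> * e + 2 * (if \<bar>y - x\<bar> > e then 1 else 0)" for x y :: real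
      proof (cases "\<bar>y - x\<bar> > e")
        case True
        have "norm (iexp (t * y) - iexp (t * x)) \<le> norm (iexp (t * y)) + norm (iexp (t * x))" by (rule norm_triangle_ineq4)
        also have "\<dots> = 2" by simp
        also have "\<dots> \<le> \<bar>t\<bar> * e + 2" using e by simp
        finally show ?thesis using True by simp
      next
        case False
        have "iexp (t * y) - iexp (t * x) = iexp (t * x) * (iexp (t * (y - x)) - 1)"
          by (simp add: algebra_simps exp_add[symmetric])
        then have "norm (iexp (t * y) - iexp (t * x)) = norm (iexp (t * (y - x)) - 1)"
          by (simp add: norm_mult)
        also have "\<dots> \<le> \<bar>t * (y - x)\<bar>" using iexp_approx1[of "t * (y - x)" 0] by simp
        also have "\<dots> \<le> \<bar>t\<bar> * e" using False by (simp add: abs_mult mult_left_mono)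
        finally show ?thesis using False by simp
      qed
      have "norm (char (distr M borel (Y n)) t - char (distr M borel (X n)) t) = norm (CLINT \<omega>|M. iexp (t * Y n \<omega>) - iexp (t * X n \<omega>))"
        by (subst Bochner_Integration.integral_diff[OF int int]) (simp_all add: char_distr)
      also have "\<dots> \<le> (\<integral>\<omega>. norm (iexp (t * Y n \<omega>) - iexp (t * X n \<omega>)) \<partial>M)"
        by (rule integral_norm_bound)
      also have "\<dots> \<le> (\<integral>\<omega>. \<bar>t\<bar> * e + 2 * indicator {\<omega>\<in>space M. \<bar>Y n \<omega> - X n \<omega>\<bar> > e} \<omega> \<partial>M)"
      proof (rule integral_mono)
        show "integrable M (\<lambda>\<omega>. norm (iexp (t * Y n \<omega>) - iexp (t * X n \<omega>)))"
          by (intro integrable_norm Bochner_Integration.integrable_diff int) simp_all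
        show "norm (iexp (t * Y n \<omega>) - iexp (t * X n \<omega>)) \<le> \<bar>t\<bar> * e + 2 * indicator {\<omega>\<in>space M. \<bar>Y n \<omega> - X n \<omega>\<bar> > e} \<omega>" if "\<omega> \<in> space M" for \<omega>
          using pt[of "Y n \<omega>" "X n \<omega>"] that by (auto simp: indicator_def)
      qed (auto intro!: integrable_real_indicator simp: emeasure_eq_measure)
      also have "\<dots> = \<bar>t\<bar> * e + 2 * prob {\<omega>\<in>space M. \<bar>Y n \<omega> - X n \<omega>\<bar> > e}"
        by (subst Bochner_Integration.integral_add) (auto intro!: integrable_real_indicator simp: prob_space emeasure_eq_measure)
      also have "\<dots> < r" using te n0[OF that] by simp
      finally show ?thesis .
    qed
    then show "\<exists>n0. \<forall>n\<ge>n0. norm (char (distr M borel (Y n)) t - char (distr M borel (X n)) t - 0) < r" by auto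
  qed
  from tendsto_add[OF X this] show "(\<lambda>n. char (distr M borel (Y n)) t) \<longlonglongrightarrow> char \<mu> t" by simp
qed (use \<mu> in auto)

lemma prob_abs_gt_tendsto_0_of_AE:
  fixes E :: "nat \<Rightarrow> 'a \<Rightarrow> real"
  assumes [measurable]: "\<And>n. E n \<in> borel_measurable M"
    and E: "AE \<omega> in M. (\<lambda>n. E n \<omega>) \<longlonglongrightarrow> 0" and "e > 0"
  shows "(\<lambda>n. prob {\<omega>\<in>space M. \<bar>E n \<omega>\<bar> > e}) \<longlonglongrightarrow> 0"
proof -
  have "(\<lambda>n. expectation (indicator {\<omega>\<in>space M. \<bar>E n \<omega>\<bar> > e})) \<longlonglongrightarrow> expectation (\<lambda>_. 0 :: real)"
  proof (rule integral_dominated_convergence)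
    show "AE \<omega> in M. (\<lambda>n. indicator {\<omega>\<in>space M. \<bar>E n \<omega>\<bar> > e} \<omega>) \<longlonglongrightarrow> (0::real)"
      using E
    proof eventually_elim
      case (elim \<omega>)
      then have "\<forall>\<^sub>F n in sequentially. \<bar>E n \<omega>\<bar> < e"
        using \<open>e > 0\<close> by (intro order_tendstoD(2)[OF tendsto_rabs_zero]) auto
      then have "\<forall>\<^sub>F n in sequentially. indicator {\<omega>\<in>space M. \<bar>E n \<omega>\<bar> > e} \<omega> = (0::real)"
        by eventually_elim auto
      then show ?case by (rule tendsto_eventually)
    qed
    show "AE \<omega> in M. norm (indicator {\<omega>\<in>space M. \<bar>E n \<omega>\<bar> > e} \<omega> :: real) \<le> 1" for n
      by (simp add: indicator_def)
  qed auto
  then show ?thesis by simp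
qed

text \<open>A weakly convergent sequence is bounded in probability, so a null factor makes the
  product small: either |V n| exceeds K + 1, or |E n| exceeds e / (K + 1), or the product is at most
  e.\<close>

lemma prob_abs_mult_gt_tendsto_0:
  fixes V E :: "nat \<Rightarrow> 'a \<Rightarrow> real"
  assumes [measurable]: "\<And>n. V n \<in> borel_measurable M" "\<And>n. E n \<in> borel_measurable M"
    and \<mu>: "real_distribution \<mu>" and conv: "weak_conv_m (\<lambda>n. distr M borel (V n)) \<mu>"
    and E: "AE \<omega> in M. (\<lambda>n. E n \<omega>) \<longlonglongrightarrow> 0" and "e > 0"
  shows "(\<lambda>n. prob {\<omega>\<in>space M. \<bar>V n \<omega> * E n \<omega>\<bar> > e}) \<longlonglongrightarrow> 0"
proof (rule LIMSEQ_I)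
  fix r :: real assume "r > 0"
  interpret \<mu>: real_distribution \<mu> by fact
  \<comment> \<open>A bounded continuous majorant of the indicator of |x| > K + 1. Weak convergence
    may be tested with it, and its integral under the limit law tends to 0 as K grows.\<close>
  define g where "g K x = min 1 (\<bar>x\<bar> / real (Suc K))" for K x
  have gm: "g K \<in> borel_measurable borel" for K unfolding g_def by measurable
  note [measurable] = gm
  have gb: "norm (g K x) \<le> 1" for K x unfolding g_def by auto
  have "(\<lambda>K. \<integral>x. g K x \<partial>\<mu>) \<longlonglongrightarrow> (\<integral>x. 0 \<partial>\<mu>)"
  proof (rule integral_dominated_convergence)
    show "AE x in \<mu>. (\<lambda>K. g K x) \<longlonglongrightarrow> 0"
    proof (rule AE_I2)
      fix x :: real
      have "(\<lambda>K. \<bar>x\<bar> / real K) \<longlonglongrightarrow> 0" by (rule lim_const_over_n)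
      then have "(\<lambda>K. min 1 (\<bar>x\<bar> / real (Suc K))) \<longlonglongrightarrow> min 1 0"
        by (intro tendsto_min tendsto_const LIMSEQ_Suc)
      then show "(\<lambda>K. g K x) \<longlonglongrightarrow> 0" by (simp add: g_def)
    qed
    show "AE x in \<mu>. norm (g K x) \<le> 1" for K by (simp only: gb) simp
  qed auto
  then have "\<forall>\<^sub>F K in sequentially. (\<integral>x. g K x \<partial>\<mu>) < r / 2"
    using \<open>r > 0\<close> by (intro order_tendstoD(2)) auto
  then obtain K where K: "(\<integral>x. g K x \<partial>\<mu>) < r / 2" by (auto simp: eventually_sequentially)
  have "(\<lambda>n. integral\<^sup>L (distr M borel (V n)) (g K)) \<longlonglongrightarrow> integral\<^sup>L \<mu> (g K)"
    by (rule weak_conv_imp_integral_bdd_continuous_conv[OF _ \<mu> conv _ gb])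
       (auto simp: g_def intro!: continuous_intros)
  then have ev1: "\<forall>\<^sub>F n in sequentially. integral\<^sup>L (distr M borel (V n)) (g K) < r / 2"
    using K by (rule order_tendstoD(2))
  have "(\<lambda>n. prob {\<omega>\<in>space M. \<bar>E n \<omega>\<bar> > e / real (Suc K)}) \<longlonglongrightarrow> 0"
    by (rule prob_abs_gt_tendsto_0_of_AE) (use E \<open>e > 0\<close> in auto)
  then have ev2: "\<forall>\<^sub>F n in sequentially. prob {\<omega>\<in>space M. \<bar>E n \<omega>\<bar> > e / real (Suc K)} < r / 2"
    using \<open>r > 0\<close> by (intro order_tendstoD(2)) auto
  have "\<forall>\<^sub>F n in sequentially. prob {\<omega>\<in>space M. \<bar>V n \<omega> * E n \<omega>\<bar> > e} < r"
    using ev1 ev2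
  proof eventually_elim
    case (elim n)
    have "prob {\<omega>\<in>space M. \<bar>V n \<omega>\<bar> > real (Suc K)} = expectation (indicator {\<omega>\<in>space M. \<bar>V n \<omega>\<bar> > real (Suc K)})" by simp
    also have "\<dots> \<le> expectation (\<lambda>\<omega>. g K (V n \<omega>))"
    proof (rule integral_mono)
      show "integrable M (\<lambda>\<omega>. g K (V n \<omega>))" by (rule integrable_const_bound[of _ 1]) (use gb in auto)
      show "indicator {\<omega>\<in>space M. \<bar>V n \<omega>\<bar> > real (Suc K)} \<omega> \<le> g K (V n \<omega>)" if "\<omega> \<in> space M" for \<omega>
        by (auto simp: indicator_def g_def field_simps)
    qed (auto intro!: integrable_real_indicator simp: emeasure_eq_measure simp del: of_nat_Suc)
    also have "\<dots> = integral\<^sup>L (distr M borel (V n)) (g K)" by (subst integral_distr) auto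
    finally have V: "prob {\<omega>\<in>space M. \<bar>V n \<omega>\<bar> > real (Suc K)} < r / 2" using elim(1) by simp
    have "{\<omega>\<in>space M. \<bar>V n \<omega> * E n \<omega>\<bar> > e} \<subseteq> {\<omega>\<in>space M. \<bar>V n \<omega>\<bar> > real (Suc K)} \<union> {\<omega>\<in>space M. \<bar>E n \<omega>\<bar> > e / real (Suc K)}"
    proof (rule subsetI, rule ccontr)
      fix \<omega> assume "\<omega> \<in> {\<omega>\<in>space M. \<bar>V n \<omega> * E n \<omega>\<bar> > e}"
        and "\<omega> \<notin> {\<omega>\<in>space M. \<bar>V n \<omega>\<bar> > real (Suc K)} \<union> {\<omega>\<in>space M. \<bar>E n \<omega>\<bar> > e / real (Suc K)}"
      then have "\<bar>V n \<omega>\<bar> * \<bar>E n \<omega>\<bar> > e" "\<bar>V n \<omega>\<bar> \<le> real (Suc K)" "\<bar>E n \<omega>\<bar> \<le> e / real (Suc K)"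
        by (auto simp: abs_mult)
      moreover from this(2,3) have "\<bar>V n \<omega>\<bar> * \<bar>E n \<omega>\<bar> \<le> real (Suc K) * (e / real (Suc K))"
        by (intro mult_mono) auto
      ultimately show False by (simp del: of_nat_Suc)
    qed
    then have "prob {\<omega>\<in>space M. \<bar>V n \<omega> * E n \<omega>\<bar> > e} \<le> prob ({\<omega>\<in>space M. \<bar>V n \<omega>\<bar> > real (Suc K)} \<union> {\<omega>\<in>space M. \<bar>E n \<omega>\<bar> > e / real (Suc K)})"
      by (intro finite_measure_mono) (auto simp del: of_nat_Suc)
    also have "\<dots> \<le> prob {\<omega>\<in>space M. \<bar>V n \<omega>\<bar> > real (Suc K)} + prob {\<omega>\<in>space M. \<bar>E n \<omega>\<bar> > e / real (Suc K)}"
      by (rule measure_Un_le) (auto simp del: of_nat_Suc)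
    finally show ?case using V elim(2) by linarith
  qed
  then show "\<exists>n0. \<forall>n\<ge>n0. norm (prob {\<omega>\<in>space M. \<bar>V n \<omega> * E n \<omega>\<bar> > e} - 0) < r"
    by (simp add: eventually_sequentially)
qed

end

section \<open>Weak convergence of independent coordinates\<close>

lemma distr_PiM_coordinatewise:
  assumes "finite I" "\<And>i. prob_space (\<Omega> i)" "\<And>i. Y i \<in> borel_measurable (\<Omega> i)"
  shows "distr (PiM I \<Omega>) (PiM I (\<lambda>_. borel)) (\<lambda>\<omega>. \<lambda>i\<in>I. Y i (\<omega> i)) = PiM I (\<lambda>i. distr (\<Omega> i) borel (Y i))"
proof -
  note [measurable] = assms(3)
  interpret \<Omega>: product_prob_space \<Omega> I by (rule product_prob_spaceI) (rule assms)
  interpret D: product_prob_space "\<lambda>i. distr (\<Omega> i) borel (Y i)" I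
    by (rule product_prob_spaceI) (intro prob_space.prob_space_distr assms)
  show ?thesis
  proof (rule D.PiM_eqI[OF \<open>finite I\<close>])
    show "sets (distr (PiM I \<Omega>) (PiM I (\<lambda>_. borel)) (\<lambda>\<omega>. \<lambda>i\<in>I. Y i (\<omega> i))) = sets (PiM I (\<lambda>i. distr (\<Omega> i) borel (Y i)))"
      by (simp cong: sets_PiM_cong)
    fix A assume "\<And>i. i \<in> I \<Longrightarrow> A i \<in> sets (distr (\<Omega> i) borel (Y i))"
    then have A: "\<And>i. i \<in> I \<Longrightarrow> A i \<in> sets borel" by simp
    have "(\<lambda>\<omega>. \<lambda>i\<in>I. Y i (\<omega> i)) -` Pi\<^sub>E I A \<inter> space (PiM I \<Omega>) = Pi\<^sub>E I (\<lambda>i. Y i -` A i \<inter> space (\<Omega> i))"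
      by (auto simp: space_PiM PiE_iff)
    then have "emeasure (distr (PiM I \<Omega>) (PiM I (\<lambda>_. borel)) (\<lambda>\<omega>. \<lambda>i\<in>I. Y i (\<omega> i))) (Pi\<^sub>E I A)
      = emeasure (PiM I \<Omega>) (Pi\<^sub>E I (\<lambda>i. Y i -` A i \<inter> space (\<Omega> i)))"
      using A \<open>finite I\<close> by (subst emeasure_distr) (auto intro!: sets_PiM_I_finite)
    also have "\<dots> = (\<Prod>i\<in>I. emeasure (\<Omega> i) (Y i -` A i \<inter> space (\<Omega> i)))"
      using A \<open>finite I\<close> by (intro \<Omega>.emeasure_PiM) auto
    also have "\<dots> = (\<Prod>i\<in>I. emeasure (distr (\<Omega> i) borel (Y i)) (A i))"
      using A by (intro prod.cong refl) (simp add: emeasure_distr)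
    finally show "emeasure (distr (PiM I \<Omega>) (PiM I (\<lambda>_. borel)) (\<lambda>\<omega>. \<lambda>i\<in>I. Y i (\<omega> i))) (Pi\<^sub>E I A)
      = (\<Prod>i\<in>I. emeasure (distr (\<Omega> i) borel (Y i)) (A i))" .
  qed
qed

text \<open>Continuity of h is asked for along sequences converging at each coordinate of I, which
  is exactly what pointwise convergence on the product of the representing spaces provides for
  dominated convergence.\<close>

lemma integral_PiM_weak_conv:
  fixes h :: "('i \<Rightarrow> real) \<Rightarrow> 'b::{banach, second_countable_topology}"
  assumes "finite I" and \<mu>: "\<And>i n. real_distribution (\<mu> i n)" and \<nu>: "\<And>i. real_distribution (\<nu> i)"
    and conv: "\<And>i. weak_conv_m (\<mu> i) (\<nu> i)"
    and [measurable]: "h \<in> borel_measurable (PiM I (\<lambda>_. borel))"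
    and bound: "\<And>x. norm (h x) \<le> B"
    and cont: "\<And>x y. (\<And>i. i \<in> I \<Longrightarrow> (\<lambda>n. x n i) \<longlonglongrightarrow> y i) \<Longrightarrow> (\<lambda>n. h (x n)) \<longlonglongrightarrow> h y"
  shows "(\<lambda>n. \<integral>x. h x \<partial>PiM I (\<lambda>i. \<mu> i n)) \<longlonglongrightarrow> (\<integral>x. h x \<partial>PiM I \<nu>)"
proof -
  have "\<forall>i. \<exists>(\<Omega> :: real measure) Y Y'. prob_space \<Omega> \<and> (\<forall>n. Y n \<in> borel_measurable \<Omega>) \<and>
    (\<forall>n. distr \<Omega> borel (Y n) = \<mu> i n) \<and> Y' \<in> borel_measurable \<Omega> \<and> distr \<Omega> borel Y' = \<nu> i \<and>
    (\<forall>x \<in> space \<Omega>. (\<lambda>n. Y n x) \<longlonglongrightarrow> Y' x)"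
    using Skorohod[OF \<mu> \<nu> conv] by simp
  then obtain \<Omega> :: "'i \<Rightarrow> real measure" and Y Y' where
    \<Omega>: "\<And>i. prob_space (\<Omega> i)" and Y: "\<And>i n. Y i n \<in> borel_measurable (\<Omega> i)"
    and dY: "\<And>i n. distr (\<Omega> i) borel (Y i n) = \<mu> i n"
    and Y': "\<And>i. Y' i \<in> borel_measurable (\<Omega> i)" and dY': "\<And>i. distr (\<Omega> i) borel (Y' i) = \<nu> i"
    and lim: "\<And>i x. x \<in> space (\<Omega> i) \<Longrightarrow> (\<lambda>n. Y i n x) \<longlonglongrightarrow> Y' i x"
    by metis
  note [measurable] = Y Y'
  interpret \<Omega>: product_prob_space \<Omega> I by (rule product_prob_spaceI) (rule \<Omega>)
  have "(\<integral>x. h x \<partial>PiM I (\<lambda>i. \<mu> i n)) = (\<integral>\<omega>. h (\<lambda>i\<in>I. Y i n (\<omega> i)) \<partial>PiM I \<Omega>)" for n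
    using distr_PiM_coordinatewise[of I \<Omega> "\<lambda>i. Y i n", OF \<open>finite I\<close> \<Omega> Y]
    by (subst dY[symmetric], subst integral_distr[symmetric, where N="PiM I (\<lambda>_. borel)"]) (auto simp: dY)
  moreover have "(\<integral>x. h x \<partial>PiM I \<nu>) = (\<integral>\<omega>. h (\<lambda>i\<in>I. Y' i (\<omega> i)) \<partial>PiM I \<Omega>)"
    using distr_PiM_coordinatewise[of I \<Omega> Y', OF \<open>finite I\<close> \<Omega> Y']
    by (subst integral_distr[symmetric, where N="PiM I (\<lambda>_. borel)"]) (auto simp: dY')
  moreover have "(\<lambda>n. \<integral>\<omega>. h (\<lambda>i\<in>I. Y i n (\<omega> i)) \<partial>PiM I \<Omega>) \<longlonglongrightarrow> (\<integral>\<omega>. h (\<lambda>i\<in>I. Y' i (\<omega> i)) \<partial>PiM I \<Omega>)"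
  proof (rule integral_dominated_convergence[where w="\<lambda>_. B"])
    show "AE \<omega> in PiM I \<Omega>. (\<lambda>n. h (\<lambda>i\<in>I. Y i n (\<omega> i))) \<longlonglongrightarrow> h (\<lambda>i\<in>I. Y' i (\<omega> i))"
      by (intro AE_I2 cont) (auto simp: space_PiM PiE_iff intro!: lim)
  qed (use bound in auto)
  ultimately show ?thesis by simp
qed

text \<open>Skorohod's theorem applied to each coordinate, followed by a product of the representing
  spaces, replaces a multivariate weak convergence theory.\<close>

lemma (in prob_space) weak_conv_continuous_map_indep:
  fixes X :: "nat \<Rightarrow> 'i \<Rightarrow> 'a \<Rightarrow> real" and q :: "('i \<Rightarrow> real) \<Rightarrow> real"
  assumes I: "finite I" "I \<noteq> {}" and ind: "\<And>n. indep_vars (\<lambda>_. borel) (X n) I"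
    and \<nu>: "real_distribution \<nu>"
    and conv: "\<And>i. i \<in> I \<Longrightarrow> weak_conv_m (\<lambda>n. distr M borel (X n i)) \<nu>"
    and [measurable]: "q \<in> borel_measurable (PiM I (\<lambda>_. borel))"
    and cont: "\<And>x y. (\<And>i. i \<in> I \<Longrightarrow> (\<lambda>n. x n i) \<longlonglongrightarrow> y i) \<Longrightarrow> (\<lambda>n. q (x n)) \<longlonglongrightarrow> q y"
  shows "weak_conv_m (\<lambda>n. distr M borel (\<lambda>\<omega>. q (\<lambda>i\<in>I. X n i \<omega>))) (distr (PiM I (\<lambda>_. \<nu>)) borel q)"
proof (rule levy_continuity)
  interpret \<nu>: real_distribution \<nu> by fact
  interpret P: product_prob_space "\<lambda>_. \<nu>" I by (rule product_prob_spaceI) (rule \<nu>.prob_space_axioms)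
  have [measurable]: "X n i \<in> borel_measurable M" if "i \<in> I" for n i
    using ind[of n] that by (auto simp: indep_vars_def)
  have [measurable_cong]: "sets (PiM I (\<lambda>_. \<nu>)) = sets (PiM I (\<lambda>_. borel))"
    by (intro sets_PiM_cong) simp_all
  show "real_distribution (distr M borel (\<lambda>\<omega>. q (\<lambda>i\<in>I. X n i \<omega>)))" for n by simp
  show "real_distribution (distr (PiM I (\<lambda>_. \<nu>)) borel q)" by (rule P.real_distribution_distr) simp
  fix t
  \<comment> \<open>Outside I the family is padded with the limit law, because the preceding lemma
    asks for probability laws and weak convergence at every index.\<close>
  define \<mu> where "\<mu> i n = (if i \<in> I then distr M borel (X n i) else \<nu>)" for i n
  have "char (distr M borel (\<lambda>\<omega>. q (\<lambda>i\<in>I. X n i \<omega>))) t = (CLINT x|PiM I (\<lambda>i. \<mu> i n). iexp (t * q x))" for n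
  proof -
    have "PiM I (\<lambda>i. \<mu> i n) = PiM I (\<lambda>i. distr M borel (X n i))"
      by (rule PiM_cong) (auto simp: \<mu>_def)
    also have "\<dots> = distr M (PiM I (\<lambda>_. borel)) (\<lambda>\<omega>. \<lambda>i\<in>I. X n i \<omega>)"
      using ind[of n] I by (subst (asm) indep_vars_iff_distr_eq_PiM') auto
    finally show ?thesis
      unfolding char_def by (simp add: integral_distr)
  qed
  moreover have "char (distr (PiM I (\<lambda>_. \<nu>)) borel q) t = (CLINT x|PiM I (\<lambda>_. \<nu>). iexp (t * q x))"
    unfolding char_def by (simp add: integral_distr)
  moreover have "(\<lambda>n. CLINT x|PiM I (\<lambda>i. \<mu> i n). iexp (t * q x)) \<longlonglongrightarrow> (CLINT x|PiM I (\<lambda>_. \<nu>). iexp (t * q x))"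
  proof (rule integral_PiM_weak_conv[where B=1])
    show "real_distribution (\<mu> i n)" for i n using \<nu> by (auto simp: \<mu>_def)
    show "weak_conv_m (\<mu> i) \<nu>" for i
      using conv[of i] by (cases "i \<in> I") (auto simp: \<mu>_def weak_conv_m_def weak_conv_def)
    show "(\<lambda>n. iexp (t * q (x n))) \<longlonglongrightarrow> iexp (t * q y)" if "\<And>i. i \<in> I \<Longrightarrow> (\<lambda>n. x n i) \<longlonglongrightarrow> y i" for x y
      by (intro tendsto_intros cont that)
  qed (use I \<nu> in auto)
  ultimately show "(\<lambda>n. char (distr M borel (\<lambda>\<omega>. q (\<lambda>i\<in>I. X n i \<omega>))) t) \<longlonglongrightarrow> char (distr (PiM I (\<lambda>_. \<nu>)) borel q) t"
    by simp
qed

subsection \<open>Quadratic forms\<close>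

text \<open>A weighted variance of the points d_i / c_i with weights c_i: their mean is sum d / sum
  c, and moving all points by the same f moves the mean along. So f is free, and the development
  factor is the choice that makes d_i - f c_i a sum of centered claims.\<close>

lemma weighted_residual_square_sum:
  fixes c d :: "'i \<Rightarrow> real"
  assumes "finite I" "\<And>i. i \<in> I \<Longrightarrow> c i \<noteq> 0" "sum c I \<noteq> 0"
  shows "(\<Sum>i\<in>I. c i * (d i / c i - sum d I / sum c I)\<^sup>2)
    = (\<Sum>i\<in>I. (d i - f * c i)\<^sup>2 / c i) - (\<Sum>i\<in>I. d i - f * c i)\<^sup>2 / sum c I"
proof -
  define e where "e i = d i - f * c i" for i
  define r where "r = sum e I / sum c I"
  have se: "sum e I = sum d I - f * sum c I" by (simp add: e_def sum_subtractf sum_distrib_left)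
  have "sum d I / sum c I = r + f" using assms(3) by (simp add: r_def se field_simps)
  then have "c i * (d i / c i - sum d I / sum c I)\<^sup>2 = (e i)\<^sup>2 / c i - 2 * r * e i + r\<^sup>2 * c i" if "i \<in> I" for i
  proof -
    have "d i / c i - (r + f) = e i / c i - r" using assms(2)[OF that] by (simp add: e_def field_simps)
    then show ?thesis using assms(2)[OF that] \<open>sum d I / sum c I = r + f\<close> by (simp add: power2_eq_square field_simps)
  qed
  then have "(\<Sum>i\<in>I. c i * (d i / c i - sum d I / sum c I)\<^sup>2) = (\<Sum>i\<in>I. (e i)\<^sup>2 / c i - 2 * r * e i + r\<^sup>2 * c i)"
    by (rule sum.cong[OF refl])
  also have "\<dots> = (\<Sum>i\<in>I. (e i)\<^sup>2 / c i) - 2 * r * sum e I + r\<^sup>2 * sum c I"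
    by (simp add: sum.distrib sum_subtractf sum_distrib_left)
  also have "\<dots> = (\<Sum>i\<in>I. (e i)\<^sup>2 / c i) - (sum e I)\<^sup>2 / sum c I"
    using assms(3) by (simp add: r_def power2_eq_square field_simps)
  finally show ?thesis by (simp add: e_def)
qed

text \<open>Each |x_i x_j| is at most |x|^2, so |x|^2 factors out and only coefficient differences
  remain. This separates a factor bounded in probability from one that tends to 0.\<close>

lemma quadratic_form_perturbation:
  fixes x a a' :: "'i \<Rightarrow> real" and k k' :: "'i \<Rightarrow> 'i \<Rightarrow> real"
  assumes "finite I"
  shows "\<bar>((\<Sum>i\<in>I. (x i)\<^sup>2 * a i) - (\<Sum>i\<in>I. \<Sum>j\<in>I. x i * x j * k i j)) - ((\<Sum>i\<in>I. (x i)\<^sup>2 * a' i) - (\<Sum>i\<in>I. \<Sum>j\<in>I. x i * x j * k' i j))\<bar>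
    \<le> (\<Sum>i\<in>I. (x i)\<^sup>2) * ((\<Sum>i\<in>I. \<bar>a i - a' i\<bar>) + (\<Sum>i\<in>I. \<Sum>j\<in>I. \<bar>k i j - k' i j\<bar>))"
proof -
  define V where "V = (\<Sum>i\<in>I. (x i)\<^sup>2)"
  have sq: "(x i)\<^sup>2 \<le> V" if "i \<in> I" for i
    unfolding V_def by (rule member_le_sum) (use that assms in auto)
  have pr: "\<bar>x i * x j\<bar> \<le> V" if "i \<in> I" "j \<in> I" for i j
  proof -
    have "2 * \<bar>x i * x j\<bar> \<le> (x i)\<^sup>2 + (x j)\<^sup>2"
      using sum_squares_bound[of "\<bar>x i\<bar>" "\<bar>x j\<bar>"] by (simp add: abs_mult)
    then show ?thesis using sq[OF that(1)] sq[OF that(2)] by simp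
  qed
  have eq: "((\<Sum>i\<in>I. (x i)\<^sup>2 * a i) - (\<Sum>i\<in>I. \<Sum>j\<in>I. x i * x j * k i j)) - ((\<Sum>i\<in>I. (x i)\<^sup>2 * a' i) - (\<Sum>i\<in>I. \<Sum>j\<in>I. x i * x j * k' i j))
    = (\<Sum>i\<in>I. (x i)\<^sup>2 * (a i - a' i)) - (\<Sum>i\<in>I. \<Sum>j\<in>I. x i * x j * (k i j - k' i j))"
    by (simp add: right_diff_distrib sum_subtractf)
  have "\<bar>\<Sum>i\<in>I. (x i)\<^sup>2 * (a i - a' i)\<bar> \<le> (\<Sum>i\<in>I. V * \<bar>a i - a' i\<bar>)"
    by (rule order_trans[OF sum_abs], rule sum_mono) (auto simp: abs_mult intro!: mult_right_mono sq)
  moreover have "\<bar>\<Sum>i\<in>I. \<Sum>j\<in>I. x i * x j * (k i j - k' i j)\<bar> \<le> (\<Sum>i\<in>I. \<Sum>j\<in>I. V * \<bar>k i j - k' i j\<bar>)"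
  proof (rule order_trans[OF sum_abs], rule sum_mono, rule order_trans[OF sum_abs], rule sum_mono)
    fix i j assume "i \<in> I" "j \<in> I"
    then show "\<bar>x i * x j * (k i j - k' i j)\<bar> \<le> V * \<bar>k i j - k' i j\<bar>"
      unfolding abs_mult[of "x i * x j"] by (intro mult_right_mono pr) auto
  qed
  ultimately show ?thesis
    unfolding eq V_def[symmetric] distrib_left sum_distrib_left by linarith
qed

subsection \<open>The chain ladder model\<close>

abbreviation (input) claim_space :: "(nat \<times> real) measure" where
  "claim_space \<equiv> count_space UNIV \<Otimes>\<^sub>M borel"

locale chain_ladder = prob_space M for M :: "'a measure" +
  fixes T :: nat
    and N :: "nat \<Rightarrow> real \<Rightarrow> 'a \<Rightarrow> nat"
    and D :: "nat \<Rightarrow> nat \<Rightarrow> 'a \<Rightarrow> nat"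
    and Z :: "nat \<Rightarrow> nat \<Rightarrow> 'a \<Rightarrow> real"
    and P :: "(nat \<times> real) measure"
    and lam :: "nat \<Rightarrow> real"
  assumes T2: "T \<ge> 2"
    and D_range: "\<And>i k \<omega>. i \<in> {1..T} \<Longrightarrow> k \<ge> 1 \<Longrightarrow> \<omega> \<in> space M \<Longrightarrow> D i k \<omega> \<in> {1..T}"
    and claims_indep: "\<And>i. i \<in> {1..T} \<Longrightarrow> indep_vars (\<lambda>_. claim_space) (\<lambda>k \<omega>. (D i k \<omega>, Z i k \<omega>)) {1::nat..}"
    and claims_distr: "\<And>i k. i \<in> {1..T} \<Longrightarrow> k \<ge> 1 \<Longrightarrow> distr M claim_space (\<lambda>\<omega>. (D i k \<omega>, Z i k \<omega>)) = P"
    and square_integrable: "integrable P (\<lambda>x. (snd x)\<^sup>2)"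
    and mean_eq_pos: "\<And>t. t \<in> {1..T} \<Longrightarrow> (\<integral>x. (if fst x = t then snd x else 0) \<partial>P) > 0"
    and number_claims_indep: "\<And>i. i \<in> {1..T} \<Longrightarrow>
       indep_rvs M
         (Pi\<^sub>M {1::nat..} (\<lambda>_. claim_space)) (\<lambda>\<omega>. \<lambda>k\<in>{1::nat..}. (D i k \<omega>, Z i k \<omega>))
         (Pi\<^sub>M {0::real..} (\<lambda>_. count_space UNIV)) (\<lambda>\<omega>. \<lambda>\<alpha>\<in>{0::real..}. N i \<alpha> \<omega>)"
    and years_indep: "indep_vars
       (\<lambda>_. Pi\<^sub>M {0::real..} (\<lambda>_. count_space UNIV) \<Otimes>\<^sub>M Pi\<^sub>M {1::nat..} (\<lambda>_. claim_space))
       (\<lambda>i \<omega>. (\<lambda>\<alpha>\<in>{0::real..}. N i \<alpha> \<omega>, \<lambda>k\<in>{1::nat..}. (D i k \<omega>, Z i k \<omega>))) {1..T}"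
    and exposure: "\<And>i. i \<in> {1..T} \<Longrightarrow> lam i > 0 \<and>
       (AE \<omega> in M. ((\<lambda>\<alpha>. real (N i \<alpha> \<omega>) / \<alpha>) \<longlongrightarrow> lam i) at_top)"
begin

definition mean_le :: "nat \<Rightarrow> real" where
  "mean_le t = (\<integral>x. (if fst x \<le> t then snd x else 0) \<partial>P)"

definition sq_le :: "nat \<Rightarrow> real" where
  "sq_le t = (\<integral>x. (if fst x \<le> t then (snd x)\<^sup>2 else 0) \<partial>P)"

definition mean_eq :: "nat \<Rightarrow> real" where
  "mean_eq t = (\<integral>x. (if fst x = t then snd x else 0) \<partial>P)"

definition sq_eq :: "nat \<Rightarrow> real" where
  "sq_eq t = (\<integral>x. (if fst x = t then (snd x)\<^sup>2 else 0) \<partial>P)"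

definition dev_factor :: "nat \<Rightarrow> real" where
  "dev_factor t = mean_le (t + 1) / mean_le t"

definition limit_variance :: "nat \<Rightarrow> real" where
  "limit_variance t = (dev_factor t - 1) * (sq_eq (t + 1) / mean_eq (t + 1) + (dev_factor t - 1) * (sq_le t / mean_le t))"

section \<open>Moments of a single claim\<close>

lemma claim_measurable: "i \<in> {1..T} \<Longrightarrow> k \<ge> 1 \<Longrightarrow> (\<lambda>\<omega>. (D i k \<omega>, Z i k \<omega>)) \<in> measurable M claim_space"
  using claims_indep[of i] by (auto simp: indep_vars_def)

lemma P_distr: "P = distr M claim_space (\<lambda>\<omega>. (D 1 1 \<omega>, Z 1 1 \<omega>))"
  using claims_distr[of 1 1] T2 by simp

lemma sets_P [measurable_cong]: "sets P = sets claim_space"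
  by (simp add: P_distr)

lemma prob_space_P: "prob_space P"
  unfolding P_distr by (rule prob_space_distr) (use claim_measurable T2 in simp)

lemma AE_P_year_pos: "AE x in P. fst x \<ge> 1"
  unfolding P_distr
  by (subst AE_distr_iff) (use claim_measurable[of 1 1] D_range[of 1 1] T2 in auto)

lemma claim_integral:
  assumes "i \<in> {1..T}" "k \<ge> 1" and g: "g \<in> borel_measurable claim_space" and "integrable P g"
  shows "integrable M (\<lambda>\<omega>. g (D i k \<omega>, Z i k \<omega>) :: real)" "expectation (\<lambda>\<omega>. g (D i k \<omega>, Z i k \<omega>)) = (\<integral>x. g x \<partial>P)"
  using assms(4) claims_distr[OF assms(1,2), symmetric] claim_measurable[OF assms(1,2)] g
  by (auto simp: integrable_distr_eq integral_distr)

lemma integrable_of_dominated: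
  assumes [measurable]: "g \<in> borel_measurable claim_space" and "\<And>x. \<bar>g x\<bar> \<le> c * (snd x)\<^sup>2"
  shows "integrable P (g :: _ \<Rightarrow> real)"
proof (rule Bochner_Integration.integrable_bound)
  show "integrable P (\<lambda>x. c * (snd x)\<^sup>2)" using square_integrable by simp
  show "AE x in P. norm (g x) \<le> norm (c * (snd x)\<^sup>2)"
    using assms(2) by (intro AE_I2) (metis abs_ge_self order_trans real_norm_def)
qed measurable

lemma integrable_of_square:
  assumes [measurable]: "g \<in> borel_measurable claim_space" and "integrable P (\<lambda>x. (g x)\<^sup>2)"
  shows "integrable P (g :: _ \<Rightarrow> real)"
proof -
  interpret P: prob_space P by (rule prob_space_P)
  show ?thesis by (rule P.square_integrable_imp_integrable) (use assms in auto)
qed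

lemma year_pred_measurable: "Measurable.pred claim_space (\<lambda>x. Q (fst x))"
  by (rule measurable_compose[OF measurable_fst]) simp

lemma integrable_square_if:
  fixes Q :: "nat \<Rightarrow> bool"
  shows "integrable P (\<lambda>x. if Q (fst x) then (snd x)\<^sup>2 else 0)"
proof -
  note [measurable] = year_pred_measurable[of Q]
  show ?thesis by (rule integrable_of_dominated[of _ 1]) auto
qed

lemma integrable_mean_if:
  fixes Q :: "nat \<Rightarrow> bool"
  shows "integrable P (\<lambda>x. if Q (fst x) then snd x else 0)"
proof -
  note [measurable] = year_pred_measurable[of Q]
  show ?thesis
    by (rule integrable_of_square, measurable, rule integrable_of_dominated[of _ 1]) auto
qed

lemma mean_le_Suc: "mean_le (Suc t) = mean_le t + mean_eq (Suc t)"
proof -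
  have "mean_le (Suc t) = (\<integral>x. (if fst x \<le> t then snd x else 0) + (if fst x = Suc t then snd x else 0) \<partial>P)"
    unfolding mean_le_def by (rule Bochner_Integration.integral_cong) auto
  also have "\<dots> = mean_le t + mean_eq (Suc t)"
    unfolding mean_le_def mean_eq_def by (rule Bochner_Integration.integral_add) (rule integrable_mean_if)+
  finally show ?thesis .
qed

lemma mean_le_pos: "t \<in> {1..T} \<Longrightarrow> mean_le t > 0"
proof (induction t)
  case (Suc t)
  \<comment> \<open>Development years start at 1, so \<open>mean_le\<close> vanishes at 0 and then
    grows by the positive increments \<open>mean_eq\<close>.\<close>
  have "mean_le 0 = (\<integral>x. 0 \<partial>P)"
    unfolding mean_le_def using AE_P_year_pos
    by (intro integral_cong_AE) (measurable, auto elim!: eventually_mono)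
  then have "mean_le t \<ge> 0" using Suc by (cases "t = 0") auto
  then show ?case using mean_eq_pos[of "Suc t"] Suc.prems by (simp add: mean_le_Suc mean_eq_def)
qed simp

lemma claim_average:
  assumes i: "i \<in> {1..T}" and [measurable]: "g \<in> borel_measurable claim_space" and sq: "integrable P (\<lambda>x. (g x)\<^sup>2)"
  shows "AE \<omega> in M. (\<lambda>n. (\<Sum>k\<in>{1..n}. g (D i k \<omega>, Z i k \<omega>)) / real n) \<longlonglongrightarrow> (\<integral>x. g x \<partial>P)"
proof (rule strong_law_square_integrable)
  show "indep_vars (\<lambda>_. borel) (\<lambda>k \<omega>. g (D i k \<omega>, Z i k \<omega>)) {1..}"
    by (rule indep_vars_compose2[OF claims_indep[OF i], of "\<lambda>_. g"]) simp
  have int: "integrable P g" by (rule integrable_of_square[OF assms(2,3)])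
  show "expectation (\<lambda>\<omega>. g (D i k \<omega>, Z i k \<omega>)) = (\<integral>x. g x \<partial>P)" if "k \<ge> 1" for k
    using claim_integral[OF i that _ int] by simp
  show "integrable M (\<lambda>\<omega>. (g (D i k \<omega>, Z i k \<omega>))\<^sup>2)" if "k \<ge> 1" for k
    using claim_integral(1)[OF i that _ sq] by simp
  show "expectation (\<lambda>\<omega>. (g (D i k \<omega>, Z i k \<omega>))\<^sup>2) = (\<integral>x. (g x)\<^sup>2 \<partial>P)" if "k \<ge> 1" for k
    using claim_integral(2)[OF i that _ sq] by simp
qed

lemma filterlim_number_of_claims:
  assumes "((\<lambda>\<alpha>. real (n \<alpha>) / \<alpha>) \<longlongrightarrow> l) at_top" "l > 0"
  shows "filterlim (n :: real \<Rightarrow> nat) at_top at_top"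
proof -
  have "filterlim (\<lambda>\<alpha>. real (n \<alpha>) / \<alpha> * \<alpha>) at_top at_top"
    by (rule filterlim_tendsto_pos_mult_at_top[OF assms filterlim_ident])
  then have "filterlim (\<lambda>\<alpha>. real (n \<alpha>)) at_top at_top"
    by (rule filterlim_mono_eventually[OF _ order_refl order_refl])
       (use eventually_gt_at_top[of 0] in eventually_elim, simp)
  then show ?thesis by (simp add: filterlim_sequentially_iff_filterlim_real)
qed

section \<open>Almost sure limits\<close>

text \<open>The strong law is a statement along integers; composed with the path of the count it
  covers all real exposures with a single null set. Finitely many i and countably many t share one
  null set as well, so the later limits become deterministic arguments on one path.\<close>

lemma AE_asymptotics:
  "AE \<omega> in M. \<forall>i\<in>{1..T}. ((\<lambda>\<alpha>. real (N i \<alpha> \<omega>) / \<alpha>) \<longlongrightarrow> lam i) at_top \<and>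
     (\<forall>t. ((\<lambda>\<alpha>. cum_claims N D Z i t \<alpha> \<omega> / \<alpha>) \<longlongrightarrow> lam i * mean_le t) at_top)"
proof (rule AE_finite_allI)
  fix i assume i: "i \<in> {1..T}"
  define g :: "nat \<Rightarrow> nat \<times> real \<Rightarrow> real" where "g t x = (if fst x \<le> t then snd x else 0)" for t x
  have [measurable]: "g t \<in> borel_measurable claim_space" for t unfolding g_def by measurable
  have "AE \<omega> in M. \<forall>t. (\<lambda>n. (\<Sum>k\<in>{1..n}. g t (D i k \<omega>, Z i k \<omega>)) / real n) \<longlonglongrightarrow> (\<integral>x. g t x \<partial>P)"
    unfolding AE_all_countable
    by (intro allI claim_average i integrable_of_dominated[of _ 1]) (measurable, auto simp: g_def)
  moreover have "AE \<omega> in M. ((\<lambda>\<alpha>. real (N i \<alpha> \<omega>) / \<alpha>) \<longlongrightarrow> lam i) at_top"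
    using exposure[OF i] by simp
  ultimately show "AE \<omega> in M. ((\<lambda>\<alpha>. real (N i \<alpha> \<omega>) / \<alpha>) \<longlongrightarrow> lam i) at_top \<and>
     (\<forall>t. ((\<lambda>\<alpha>. cum_claims N D Z i t \<alpha> \<omega> / \<alpha>) \<longlongrightarrow> lam i * mean_le t) at_top)"
  proof eventually_elim
    case (elim \<omega>)
    have n: "filterlim (\<lambda>\<alpha>. N i \<alpha> \<omega>) at_top at_top"
      by (rule filterlim_number_of_claims[OF elim(2)]) (use exposure[OF i] in simp)
    have "((\<lambda>\<alpha>. cum_claims N D Z i t \<alpha> \<omega> / \<alpha>) \<longlongrightarrow> lam i * mean_le t) at_top" for t
    proof -
      have "((\<lambda>\<alpha>. (\<Sum>k\<in>{1..N i \<alpha> \<omega>}. g t (D i k \<omega>, Z i k \<omega>)) / real (N i \<alpha> \<omega>)) \<longlongrightarrow> mean_le t) at_top"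
        using filterlim_compose[OF spec[OF elim(1), of t] n] by (simp add: mean_le_def g_def)
      from tendsto_mult[OF elim(2) this]
      show ?thesis
      proof (rule Lim_transform_eventually)
        have "\<forall>\<^sub>F \<alpha> in at_top. N i \<alpha> \<omega> > 0"
          using n unfolding filterlim_at_top by (auto dest: spec[of _ 1] elim!: eventually_mono)
        then show "\<forall>\<^sub>F \<alpha> in at_top. real (N i \<alpha> \<omega>) / \<alpha> * ((\<Sum>k\<in>{1..N i \<alpha> \<omega>}. g t (D i k \<omega>, Z i k \<omega>)) / real (N i \<alpha> \<omega>)) = cum_claims N D Z i t \<alpha> \<omega> / \<alpha>"
          by eventually_elim (auto simp: cum_claims_def g_def intro!: sum.cong)
      qed
    qed
    then show ?case using elim(2) by simp
  qed
qed simp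

text \<open>The accident years differ in the limit only through their intensities. Their total L
  appears in numerator and denominator alike and cancels.\<close>

lemma fhat_tendsto:
  assumes C: "\<forall>i\<in>{1..T}. \<forall>t. ((\<lambda>\<alpha>. cum_claims N D Z i t \<alpha> \<omega> / \<alpha>) \<longlongrightarrow> lam i * mean_le t) at_top"
    and t: "t \<in> {1..T-1}"
  shows "((\<lambda>\<alpha>. fhat T N D Z t \<alpha> \<omega>) \<longlongrightarrow> dev_factor t) at_top"
proof -
  define L where "L = (\<Sum>i=1..T-t. lam i)"
  have L: "L > 0" unfolding L_def using exposure t by (intro sum_pos) auto
  have m: "mean_le t > 0" using t by (intro mean_le_pos) auto
  have "((\<lambda>\<alpha>. \<Sum>i=1..T-t. cum_claims N D Z i s \<alpha> \<omega> / \<alpha>) \<longlongrightarrow> (\<Sum>i=1..T-t. lam i * mean_le s)) at_top" for s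
    by (rule tendsto_sum) (use C in auto)
  then have S: "((\<lambda>\<alpha>. (\<Sum>i=1..T-t. cum_claims N D Z i s \<alpha> \<omega>) / \<alpha>) \<longlongrightarrow> L * mean_le s) at_top" for s
    by (simp add: L_def sum_divide_distrib sum_distrib_right)
  have "((\<lambda>\<alpha>. ((\<Sum>i=1..T-t. cum_claims N D Z i (t+1) \<alpha> \<omega>) / \<alpha>) / ((\<Sum>i=1..T-t. cum_claims N D Z i t \<alpha> \<omega>) / \<alpha>)) \<longlongrightarrow> (L * mean_le (t+1)) / (L * mean_le t)) at_top"
    by (intro tendsto_divide S) (use L m in auto)
  then have "((\<lambda>\<alpha>. ((\<Sum>i=1..T-t. cum_claims N D Z i (t+1) \<alpha> \<omega>) / \<alpha>) / ((\<Sum>i=1..T-t. cum_claims N D Z i t \<alpha> \<omega>) / \<alpha>)) \<longlongrightarrow> dev_factor t) at_top"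
    using L by (simp add: dev_factor_def)
  then show ?thesis
  proof (rule Lim_transform_eventually)
    show "\<forall>\<^sub>F \<alpha> in at_top. (\<Sum>i=1..T-t. cum_claims N D Z i (t+1) \<alpha> \<omega>) / \<alpha> / ((\<Sum>i=1..T-t. cum_claims N D Z i t \<alpha> \<omega>) / \<alpha>) = fhat T N D Z t \<alpha> \<omega>"
      using eventually_gt_at_top[of 0] by eventually_elim (simp add: fhat_def)
  qed
qed

lemma prod_dev_factor:
  assumes "1 \<le> a" "a \<le> b" "b \<le> T"
  shows "(\<Prod>t\<in>{a..<b}. dev_factor t) = mean_le b / mean_le a"
  using assms(2,3)
proof (induction b rule: dec_induct)
  case base
  then show ?case using mean_le_pos[of a] assms by simp
next
  case (step b)
  then show ?case using mean_le_pos[of b] assms by (simp add: dev_factor_def)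
qed

text \<open>The limiting development factors telescope to
  \<open>mean_le T / mean_le (T-i+1)\<close>, precisely the ratio that the observed claims still
  lack; the intensity of year i cancels.\<close>

lemma ultimate_ratio_tendsto:
  assumes C: "\<forall>i\<in>{1..T}. \<forall>t. ((\<lambda>\<alpha>. cum_claims N D Z i t \<alpha> \<omega> / \<alpha>) \<longlongrightarrow> lam i * mean_le t) at_top"
    and i: "i \<in> {2..T}"
  shows "((\<lambda>\<alpha>. cum_claims N D Z i (T-i+1) \<alpha> \<omega> * (\<Prod>t\<in>{T-i+1..T-1}. fhat T N D Z t \<alpha> \<omega>)
                 / cum_claims N D Z i T \<alpha> \<omega>) \<longlongrightarrow> 1) at_top"
proof -
  have l: "lam i > 0" using exposure[of i] i by auto
  have m: "mean_le T > 0" "mean_le (T-i+1) > 0" using i by (auto intro!: mean_le_pos)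
  have "{T-i+1..T-1} = {T-i+1..<T}" using i by auto
  then have p: "(\<Prod>t\<in>{T-i+1..T-1}. dev_factor t) = mean_le T / mean_le (T-i+1)"
  proof -
    have "T-i+1 \<le> T" using i by auto
    with prod_dev_factor[of "T-i+1" T] \<open>{T-i+1..T-1} = {T-i+1..<T}\<close> show ?thesis by simp
  qed
  have "((\<lambda>\<alpha>. (cum_claims N D Z i (T-i+1) \<alpha> \<omega> / \<alpha>) * (\<Prod>t\<in>{T-i+1..T-1}. fhat T N D Z t \<alpha> \<omega>) / (cum_claims N D Z i T \<alpha> \<omega> / \<alpha>))
     \<longlongrightarrow> (lam i * mean_le (T-i+1)) * (\<Prod>t\<in>{T-i+1..T-1}. dev_factor t) / (lam i * mean_le T)) at_top"
    by (intro tendsto_divide tendsto_mult tendsto_prod fhat_tendsto[OF C]) (use C i l m in auto)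
  then have "((\<lambda>\<alpha>. (cum_claims N D Z i (T-i+1) \<alpha> \<omega> / \<alpha>) * (\<Prod>t\<in>{T-i+1..T-1}. fhat T N D Z t \<alpha> \<omega>) / (cum_claims N D Z i T \<alpha> \<omega> / \<alpha>)) \<longlongrightarrow> 1) at_top"
    unfolding p using l m by simp
  then show ?thesis
  proof (rule Lim_transform_eventually)
    show "\<forall>\<^sub>F \<alpha> in at_top. (cum_claims N D Z i (T-i+1) \<alpha> \<omega> / \<alpha>) * (\<Prod>t\<in>{T-i+1..T-1}. fhat T N D Z t \<alpha> \<omega>) / (cum_claims N D Z i T \<alpha> \<omega> / \<alpha>)
      = cum_claims N D Z i (T-i+1) \<alpha> \<omega> * (\<Prod>t\<in>{T-i+1..T-1}. fhat T N D Z t \<alpha> \<omega>) / cum_claims N D Z i T \<alpha> \<omega>"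
      using eventually_gt_at_top[of 0] by eventually_elim simp
  qed
qed

section \<open>Centered residual claims\<close>

definition residual_claim :: "nat \<Rightarrow> nat \<times> real \<Rightarrow> real" where
  "residual_claim t x = (if fst x \<le> t + 1 then snd x else 0) - dev_factor t * (if fst x \<le> t then snd x else 0)"

definition residual_var :: "nat \<Rightarrow> real" where
  "residual_var t = (\<integral>x. (residual_claim t x)\<^sup>2 \<partial>P)"

lemma residual_claim_measurable [measurable]: "residual_claim t \<in> borel_measurable claim_space"
  unfolding residual_claim_def by measurable

text \<open>The residual is Z on D = t + 1, (1 - f) Z on D \<le> t, and 0 elsewhere. The events are
  disjoint, so squaring produces no cross term.\<close>

lemma residual_claim_square:
  "(residual_claim t x)\<^sup>2 = (if fst x = t + 1 then (snd x)\<^sup>2 else 0) + (dev_factor t - 1)\<^sup>2 * (if fst x \<le> t then (snd x)\<^sup>2 else 0)"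
  by (auto simp: residual_claim_def power2_eq_square algebra_simps)

lemma integrable_residual_claim_square: "integrable P (\<lambda>x. (residual_claim t x)\<^sup>2)"
  unfolding residual_claim_square by (intro Bochner_Integration.integrable_add integrable_mult_right integrable_square_if)

lemma residual_claim_mean: "t \<in> {1..T} \<Longrightarrow> (\<integral>x. residual_claim t x \<partial>P) = 0"
  using mean_le_pos[of t] unfolding residual_claim_def
  by (subst Bochner_Integration.integral_diff)
     (auto intro!: integrable_mult_right integrable_mean_if simp: dev_factor_def mean_le_def[symmetric])

lemma residual_var_eq: "residual_var t = sq_eq (t + 1) + (dev_factor t - 1)\<^sup>2 * sq_le t"
  unfolding residual_var_def residual_claim_square sq_eq_def sq_le_def
  by (subst Bochner_Integration.integral_add) (auto intro!: integrable_mult_right integrable_square_if)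

text \<open>A vanishing second moment would force Z = 0 almost surely on D = t, contradicting the
  positive first moment. This is the nondegeneracy that the central limit theorem requires.\<close>

lemma sq_eq_pos:
  assumes "t \<in> {1..T}"
  shows "sq_eq t > 0"
proof -
  have "sq_eq t \<noteq> 0"
  proof
    assume "sq_eq t = 0"
    then have "AE x in P. (if fst x = t then (snd x)\<^sup>2 else 0) = 0"
      unfolding sq_eq_def by (subst (asm) integral_nonneg_eq_0_iff_AE) (auto intro!: integrable_square_if)
    then have "mean_eq t = (\<integral>x. 0 \<partial>P)"
      unfolding mean_eq_def by (intro integral_cong_AE) (measurable, auto elim!: eventually_mono split: if_splits)
    then show False using mean_eq_pos[OF assms] by (simp add: mean_eq_def)
  qed
  moreover have "sq_eq t \<ge> 0" unfolding sq_eq_def by (intro Bochner_Integration.integral_nonneg) auto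
  ultimately show ?thesis by simp
qed

lemma residual_var_pos: "t + 1 \<in> {1..T} \<Longrightarrow> residual_var t > 0"
  unfolding residual_var_eq using sq_eq_pos[of "t + 1"]
  by (intro add_pos_nonneg mult_nonneg_nonneg) (auto simp: sq_le_def)

text \<open>Because \<open>dev_factor t - 1 = mean_eq (t + 1) / mean_le t\<close>, the factor
  \<open>mean_eq (t + 1)\<close> cancels. The limiting variance is thus the residual variance per
  unit of expected claim amount up to year t.\<close>

lemma limit_variance_eq:
  assumes "t \<in> {1..T}" "t + 1 \<in> {1..T}"
  shows "limit_variance t = residual_var t / mean_le t"
proof -
  have m: "mean_le t > 0" "mean_eq (t + 1) > 0" using mean_le_pos[of t] mean_eq_pos[of "t + 1"] assms by (auto simp: mean_eq_def)
  have f: "dev_factor t - 1 = mean_eq (t + 1) / mean_le t"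
    using m by (simp add: dev_factor_def mean_le_Suc field_simps)
  have "limit_variance t = (dev_factor t - 1) * (sq_eq (t + 1) / mean_eq (t + 1)) + (dev_factor t - 1)\<^sup>2 * (sq_le t / mean_le t)"
    by (simp only: limit_variance_def power2_eq_square distrib_left mult.assoc)
  also have "(dev_factor t - 1) * (sq_eq (t + 1) / mean_eq (t + 1)) = sq_eq (t + 1) / mean_le t"
    unfolding f using m by simp
  finally show ?thesis by (simp only: residual_var_eq add_divide_distrib times_divide_eq_right)
qed

section \<open>Central limit theorem with a random number of claims\<close>

text \<open>For m = 0 the value is 0 by division by zero, so that multiplying back by the square
  root recovers the empty sum too.\<close>

definition normalized_sum :: "nat \<Rightarrow> nat \<Rightarrow> nat \<Rightarrow> 'a \<Rightarrow> real" where
  "normalized_sum t i m \<omega> = (\<Sum>k\<in>{1..m}. residual_claim t (D i k \<omega>, Z i k \<omega>)) / sqrt (real m * residual_var t)"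

text \<open>Single counts inherit measurability from the whole count process, which lives on
  nonnegative exposures; hence the condition on \<alpha> here and below.\<close>

lemma number_measurable:
  assumes "i \<in> {1..T}" "\<alpha> \<ge> 0"
  shows "N i \<alpha> \<in> measurable M (count_space UNIV)"
proof -
  have "(\<lambda>\<omega>. \<lambda>\<alpha>\<in>{0::real..}. N i \<alpha> \<omega>) \<in> measurable M (Pi\<^sub>M {0::real..} (\<lambda>_. count_space UNIV))"
    using number_claims_indep[OF assms(1)] by (simp add: indep_rvs_def)
  from measurable_compose[OF this measurable_component_singleton[of \<alpha>]] show ?thesis
    using assms(2) by simp
qed

lemma claim_sum_measurable:
  "(\<lambda>c. (\<Sum>k\<in>{1..m}. residual_claim t (c k)) / sqrt (real m * residual_var t)) \<in> borel_measurable (Pi\<^sub>M {1::nat..} (\<lambda>_. claim_space))"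
proof (intro borel_measurable_divide borel_measurable_sum borel_measurable_const)
  fix k :: nat assume "k \<in> {1..m}"
  then show "(\<lambda>c. residual_claim t (c k)) \<in> borel_measurable (Pi\<^sub>M {1::nat..} (\<lambda>_. claim_space))"
    by (intro measurable_compose[where g="residual_claim t" and N=claim_space, OF _ residual_claim_measurable] measurable_component_singleton) auto
qed

lemma normalized_sum_measurable:
  assumes "i \<in> {1..T}"
  shows "normalized_sum t i m \<in> borel_measurable M"
  unfolding normalized_sum_def
proof (intro borel_measurable_divide borel_measurable_sum borel_measurable_const)
  fix k assume "k \<in> {1..m}"
  then show "(\<lambda>\<omega>. residual_claim t (D i k \<omega>, Z i k \<omega>)) \<in> borel_measurable M"
    by (intro measurable_compose[OF claim_measurable[OF assms] residual_claim_measurable]) auto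
qed

lemma normalized_sum_number_measurable:
  assumes "i \<in> {1..T}" "\<alpha> \<ge> 0"
  shows "(\<lambda>\<omega>. normalized_sum t i (N i \<alpha> \<omega>) \<omega>) \<in> borel_measurable M"
  by (rule measurable_compose_countable[OF normalized_sum_measurable[OF assms(1)] number_measurable[OF assms]])

lemma normalized_sum_weak_conv:
  assumes i: "i \<in> {1..T}" and t: "t \<in> {1..T}" "t + 1 \<in> {1..T}"
  shows "weak_conv_m (\<lambda>m. distr M borel (normalized_sum t i m)) std_normal_distribution"
proof -
  have int: "integrable P (residual_claim t)"
    by (rule integrable_of_square[OF _ integrable_residual_claim_square]) simp
  have pos: "residual_var t > 0" by (rule residual_var_pos[OF t(2)])
  have "weak_conv_m (\<lambda>n. distr M borel (\<lambda>\<omega>. (\<Sum>k<n. residual_claim t (D i (Suc k) \<omega>, Z i (Suc k) \<omega>)) / sqrt (real n * (sqrt (residual_var t))\<^sup>2))) std_normal_distribution"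
  proof (rule central_limit_theorem_zero_mean)
    show "indep_vars (\<lambda>_. borel) (\<lambda>k \<omega>. residual_claim t (D i (Suc k) \<omega>, Z i (Suc k) \<omega>)) UNIV"
      by (rule indep_vars_Suc, rule indep_vars_compose2[OF claims_indep[OF i], of "\<lambda>_. residual_claim t"]) simp
    show mean: "expectation (\<lambda>\<omega>. residual_claim t (D i (Suc k) \<omega>, Z i (Suc k) \<omega>)) = 0" for k
      using claim_integral(2)[OF i _ _ int, of "Suc k"] residual_claim_mean[OF t(1)] by simp
    show "sqrt (residual_var t) > 0" using pos by simp
    show "integrable M (\<lambda>\<omega>. (residual_claim t (D i (Suc k) \<omega>, Z i (Suc k) \<omega>))\<^sup>2)" for k
      using claim_integral(1)[OF i _ _ integrable_residual_claim_square, of "Suc k"] by simp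
    show "variance (\<lambda>\<omega>. residual_claim t (D i (Suc k) \<omega>, Z i (Suc k) \<omega>)) = (sqrt (residual_var t))\<^sup>2" for k
      unfolding mean using claim_integral(2)[OF i _ _ integrable_residual_claim_square, of "Suc k"] pos
      by (simp add: residual_var_def)
    show "distr M borel (\<lambda>\<omega>. residual_claim t (D i (Suc k) \<omega>, Z i (Suc k) \<omega>)) = distr P borel (residual_claim t)" for k
    proof -
      have "distr M borel (\<lambda>\<omega>. residual_claim t (D i (Suc k) \<omega>, Z i (Suc k) \<omega>)) = distr (distr M claim_space (\<lambda>\<omega>. (D i (Suc k) \<omega>, Z i (Suc k) \<omega>))) borel (residual_claim t)"
        by (subst distr_distr) (auto simp: comp_def intro!: claim_measurable[OF i])
      then show ?thesis by (simp add: claims_distr[OF i])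
    qed
  qed
  then show ?thesis
    unfolding normalized_sum_def using pos sum.atLeast1_atMost_eq[of "\<lambda>k. residual_claim t (D i k \<omega>, Z i k \<omega>)" for \<omega>]
    by simp
qed

text \<open>The claim sequences in the independence hypotheses are restricted to indices from 1 on,
  and sums over {1..m} do not see the cut.\<close>

lemma sum_restrict:
  "(\<Sum>k\<in>{1..m}. residual_claim t (restrict c {1::nat..} k)) = (\<Sum>k\<in>{1..m}. residual_claim t (c k))"
  by (rule sum.cong) auto

text \<open>Provides the independence hypothesis of \<open>weak_conv_random_index\<close>: both
  events are preimages under the full claim sequence and the full count process, the objects whose
  independence is assumed.\<close>

lemma number_claims_prob:
  assumes i: "i \<in> {1..T}" and \<alpha>: "\<alpha> \<ge> 0"
  shows "prob {\<omega>\<in>space M. N i \<alpha> \<omega> = m \<and> normalized_sum t i m \<omega> \<le> x}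
    = prob {\<omega>\<in>space M. N i \<alpha> \<omega> = m} * prob {\<omega>\<in>space M. normalized_sum t i m \<omega> \<le> x}"
proof -
  let ?S = "Pi\<^sub>M {1::nat..} (\<lambda>_. claim_space)" and ?S' = "Pi\<^sub>M {0::real..} (\<lambda>_. count_space (UNIV :: nat set))"
  let ?X = "\<lambda>\<omega>. \<lambda>k\<in>{1::nat..}. (D i k \<omega>, Z i k \<omega>)" and ?Y = "\<lambda>\<omega>. \<lambda>\<alpha>\<in>{0::real..}. N i \<alpha> \<omega>"
  have ind: "?X \<in> measurable M ?S" "?Y \<in> measurable M ?S'"
    "indep_set (sigma_sets (space M) {?X -` A \<inter> space M | A. A \<in> sets ?S}) (sigma_sets (space M) {?Y -` A \<inter> space M | A. A \<in> sets ?S'})"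
    using number_claims_indep[OF i] by (auto simp: indep_rvs_def)
  define A where "A = {c\<in>space ?S. (\<Sum>k\<in>{1..m}. residual_claim t (c k)) / sqrt (real m * residual_var t) \<le> x}"
  define B where "B = {n\<in>space ?S'. n \<alpha> = m}"
  have A: "A \<in> sets ?S"
    unfolding A_def using claim_sum_measurable[of t m] by (intro borel_measurable_le borel_measurable_const)
  have "(\<lambda>n. n \<alpha>) \<in> measurable ?S' (count_space UNIV)"
    by (rule measurable_component_singleton) (use \<alpha> in simp)
  from measurable_sets[OF this, of "{m}"] have B: "B \<in> sets ?S'"
    unfolding B_def by (auto simp: vimage_def Int_def conj_commute)
  have XA: "?X -` A \<inter> space M = {\<omega>\<in>space M. normalized_sum t i m \<omega> \<le> x}"
  proof -
    have "?X \<omega> \<in> A \<longleftrightarrow> normalized_sum t i m \<omega> \<le> x" if "\<omega> \<in> space M" for \<omega>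
      unfolding A_def mem_Collect_eq normalized_sum_def sum_restrict
      using measurable_space[OF ind(1) that] by (simp only: simp_thms)
    then show ?thesis by blast
  qed
  have YB: "?Y -` B \<inter> space M = {\<omega>\<in>space M. N i \<alpha> \<omega> = m}"
    using measurable_space[OF ind(2)] \<alpha> by (auto simp: B_def)
  have "prob ((?X -` A \<inter> space M) \<inter> (?Y -` B \<inter> space M)) = prob (?X -` A \<inter> space M) * prob (?Y -` B \<inter> space M)"
    by (rule indep_setD[OF ind(3)]) (use A B in \<open>auto intro!: sigma_sets.Basic\<close>)
  moreover have "{\<omega>\<in>space M. normalized_sum t i m \<omega> \<le> x} \<inter> {\<omega>\<in>space M. N i \<alpha> \<omega> = m} = {\<omega>\<in>space M. N i \<alpha> \<omega> = m \<and> normalized_sum t i m \<omega> \<le> x}"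
    by auto
  ultimately show ?thesis unfolding XA YB by (simp add: mult.commute)
qed

lemma normalized_sum_number_weak_conv:
  assumes i: "i \<in> {1..T}" and t: "t \<in> {1..T}" "t + 1 \<in> {1..T}"
    and \<alpha>: "\<And>n. \<alpha> n \<ge> 0" "filterlim \<alpha> at_top sequentially"
  shows "weak_conv_m (\<lambda>n. distr M borel (\<lambda>\<omega>. normalized_sum t i (N i (\<alpha> n) \<omega>) \<omega>)) std_normal_distribution"
proof (rule weak_conv_random_index)
  have "AE \<omega> in M. filterlim (\<lambda>\<alpha>. N i \<alpha> \<omega>) at_top at_top"
    using exposure[OF i] by (auto elim!: eventually_mono intro: filterlim_number_of_claims)
  then show "AE \<omega> in M. filterlim (\<lambda>n. N i (\<alpha> n) \<omega>) at_top sequentially"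
    by eventually_elim (rule filterlim_compose[OF _ \<alpha>(2)])
qed (use assms in \<open>auto intro!: normalized_sum_measurable number_measurable number_claims_prob normalized_sum_weak_conv\<close>)

text \<open>In every year the randomly indexed sum is the same function of the pair (count process,
  claim sequence). Its measurability, despite the random range of summation, comes from splitting on
  the countably many values of the count.\<close>

lemma normalized_sum_indep_years:
  assumes "\<alpha> \<ge> 0" "I \<subseteq> {1..T}"
  shows "indep_vars (\<lambda>_. borel) (\<lambda>i \<omega>. normalized_sum t i (N i \<alpha> \<omega>) \<omega>) I"
proof -
  let ?S = "Pi\<^sub>M {1::nat..} (\<lambda>_. claim_space)" and ?S' = "Pi\<^sub>M {0::real..} (\<lambda>_. count_space (UNIV :: nat set))"
  define \<Phi> where "\<Phi> p = (\<Sum>k\<in>{1..fst p \<alpha>}. residual_claim t (snd p k)) / sqrt (real (fst p \<alpha>) * residual_var t)" for p :: "(real \<Rightarrow> nat) \<times> (nat \<Rightarrow> nat \<times> real)"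
  have comp: "(\<lambda>p. fst p \<alpha>) \<in> measurable (?S' \<Otimes>\<^sub>M ?S) (count_space UNIV)"
    by (rule measurable_compose[OF measurable_fst measurable_component_singleton]) (use assms in simp)
  have "\<Phi> \<in> borel_measurable (?S' \<Otimes>\<^sub>M ?S)"
    unfolding \<Phi>_def
    by (rule measurable_compose_countable[OF _ comp, of "\<lambda>m p. (\<Sum>k\<in>{1..m}. residual_claim t (snd p k)) / sqrt (real m * residual_var t)"])
       (rule measurable_compose[OF measurable_snd claim_sum_measurable])
  then have "indep_vars (\<lambda>_. borel) (\<lambda>i \<omega>. \<Phi> (\<lambda>\<alpha>\<in>{0::real..}. N i \<alpha> \<omega>, \<lambda>k\<in>{1::nat..}. (D i k \<omega>, Z i k \<omega>))) {1..T}"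
    by (rule indep_vars_compose2[OF years_indep, of "\<lambda>_. \<Phi>"])
  moreover have "\<Phi> (\<lambda>\<alpha>\<in>{0::real..}. N i \<alpha> \<omega>, \<lambda>k\<in>{1::nat..}. (D i k \<omega>, Z i k \<omega>)) = normalized_sum t i (N i \<alpha> \<omega>) \<omega>" for i \<omega>
    using assms(1) unfolding \<Phi>_def normalized_sum_def fst_conv snd_conv sum_restrict by simp
  ultimately show ?thesis using assms(2) by (auto intro: indep_vars_subset)
qed

lemma cum_claims_measurable:
  assumes "i \<in> {1..T}" "\<alpha> \<ge> 0"
  shows "cum_claims N D Z i t \<alpha> \<in> borel_measurable M"
proof -
  define g :: "nat \<times> real \<Rightarrow> real" where "g x = snd x * (if fst x \<le> t then 1 else 0)" for x
  have g: "g \<in> borel_measurable claim_space" unfolding g_def by measurable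
  have "(\<lambda>\<omega>. \<Sum>k\<in>{1..m}. Z i k \<omega> * (if D i k \<omega> \<le> t then 1 else 0)) \<in> borel_measurable M" for m
  proof (rule borel_measurable_sum)
    fix k assume "k \<in> {1..m}"
    then show "(\<lambda>\<omega>. Z i k \<omega> * (if D i k \<omega> \<le> t then 1 else 0)) \<in> borel_measurable M"
      using measurable_compose[OF claim_measurable[OF assms(1), of k] g] by (simp add: g_def)
  qed
  then show ?thesis
    unfolding cum_claims_def by (rule measurable_compose_countable[OF _ number_measurable[OF assms]])
qed

section \<open>The variance estimator\<close>

lemma residual_sum_claims:
  assumes "t + 1 \<in> {1..T}"
  shows "cum_claims N D Z i (t + 1) \<alpha> \<omega> - dev_factor t * cum_claims N D Z i t \<alpha> \<omega>
    = normalized_sum t i (N i \<alpha> \<omega>) \<omega> * sqrt (real (N i \<alpha> \<omega>) * residual_var t)"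
proof -
  have "cum_claims N D Z i (t + 1) \<alpha> \<omega> - dev_factor t * cum_claims N D Z i t \<alpha> \<omega>
     = (\<Sum>k\<in>{1..N i \<alpha> \<omega>}. residual_claim t (D i k \<omega>, Z i k \<omega>))"
    unfolding cum_claims_def sum_distrib_left sum_subtractf[symmetric]
    by (rule sum.cong) (auto simp: residual_claim_def)
  then show ?thesis
    using residual_var_pos[OF assms] by (cases "N i \<alpha> \<omega> = 0") (simp_all add: normalized_sum_def)
qed

text \<open>Writing each residual as x_i sqrt(n_i s) extracts the common variance s. The remaining
  coefficients n_i / c_i and sqrt(n_i n_j) / sum c are ratios in which the exposure cancels, so they
  have almost sure limits.\<close>

lemma sigma2hat_eq_quadratic_form:
  assumes t: "t \<in> {1..T-2}" and C: "\<And>i. i \<in> {1..T-t} \<Longrightarrow> cum_claims N D Z i t \<alpha> \<omega> > 0"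
  shows "sigma2hat T N D Z t \<alpha> \<omega> = residual_var t / (real T - real t - 1) *
    ((\<Sum>i\<in>{1..T-t}. (normalized_sum t i (N i \<alpha> \<omega>) \<omega>)\<^sup>2 * (real (N i \<alpha> \<omega>) / cum_claims N D Z i t \<alpha> \<omega>))
     - (\<Sum>i\<in>{1..T-t}. \<Sum>j\<in>{1..T-t}. normalized_sum t i (N i \<alpha> \<omega>) \<omega> * normalized_sum t j (N j \<alpha> \<omega>) \<omega> *
         (sqrt (real (N i \<alpha> \<omega>) * real (N j \<alpha> \<omega>)) / (\<Sum>i\<in>{1..T-t}. cum_claims N D Z i t \<alpha> \<omega>))))"
proof -
  define s where "s = residual_var t"
  have s: "s > 0" unfolding s_def by (rule residual_var_pos) (use t in auto)
  define c where "c i = cum_claims N D Z i t \<alpha> \<omega>" for i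
  define d where "d i = cum_claims N D Z i (t + 1) \<alpha> \<omega>" for i
  define x where "x i = normalized_sum t i (N i \<alpha> \<omega>) \<omega>" for i
  define n where "n i = real (N i \<alpha> \<omega>)" for i
  have n: "n i \<ge> 0" for i by (simp add: n_def)
  have dc: "d i - dev_factor t * c i = x i * sqrt (n i * s)" for i
    unfolding c_def d_def x_def n_def s_def by (rule residual_sum_claims) (use t in auto)
  have "sum c {1..T-t} > 0" by (rule sum_pos) (use C t in \<open>auto simp: c_def\<close>)
  then have "(\<Sum>i\<in>{1..T-t}. c i * (d i / c i - sum d {1..T-t} / sum c {1..T-t})\<^sup>2)
    = (\<Sum>i\<in>{1..T-t}. (x i * sqrt (n i * s))\<^sup>2 / c i) - (\<Sum>i\<in>{1..T-t}. x i * sqrt (n i * s))\<^sup>2 / sum c {1..T-t}"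
    unfolding dc[symmetric] by (intro weighted_residual_square_sum) (use C in \<open>auto simp: c_def less_imp_neq[THEN not_sym]\<close>)
  also have "(\<Sum>i\<in>{1..T-t}. (x i * sqrt (n i * s))\<^sup>2 / c i) = s * (\<Sum>i\<in>{1..T-t}. (x i)\<^sup>2 * (n i / c i))"
    using n s by (auto simp: sum_distrib_left power_mult_distrib intro!: sum.cong)
  also have "(\<Sum>i\<in>{1..T-t}. x i * sqrt (n i * s))\<^sup>2 / sum c {1..T-t}
    = s * (\<Sum>i\<in>{1..T-t}. \<Sum>j\<in>{1..T-t}. x i * x j * (sqrt (n i * n j) / sum c {1..T-t}))"
  proof -
    have "(\<Sum>i\<in>{1..T-t}. x i * sqrt (n i * s))\<^sup>2 = (\<Sum>i\<in>{1..T-t}. \<Sum>j\<in>{1..T-t}. (x i * sqrt (n i * s)) * (x j * sqrt (n j * s)))"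
      by (simp add: power2_eq_square sum_product)
    also have "\<dots> = (\<Sum>i\<in>{1..T-t}. \<Sum>j\<in>{1..T-t}. s * (x i * x j * sqrt (n i * n j)))"
      using s by (intro sum.cong refl) (simp add: real_sqrt_mult mult_ac)
    finally show ?thesis by (simp add: sum_divide_distrib sum_distrib_left)
  qed
  finally have "(\<Sum>i\<in>{1..T-t}. c i * (d i / c i - sum d {1..T-t} / sum c {1..T-t})\<^sup>2)
    = s * ((\<Sum>i\<in>{1..T-t}. (x i)\<^sup>2 * (n i / c i)) - (\<Sum>i\<in>{1..T-t}. \<Sum>j\<in>{1..T-t}. x i * x j * (sqrt (n i * n j) / sum c {1..T-t})))"
    by (simp only: right_diff_distrib)
  then show ?thesis
    by (simp add: sigma2hat_def fhat_def c_def d_def x_def n_def s_def)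
qed

text \<open>The estimator is a quadratic form in the normalized sums with random coefficients. Freezing the
  coefficients at their almost sure limits costs an error that vanishes in probability, and the
  limiting form is \<^const>\<open>residual_sum\<close> with weights \<open>sqrt (lam i)\<close>.\<close>

lemma sigma2hat_weak_conv:
  assumes t: "t \<in> {1..T-2}" and \<alpha>: "\<And>n. \<alpha> n \<ge> 0" "filterlim \<alpha> at_top sequentially"
  shows "weak_conv_m (\<lambda>n. distr M borel (sigma2hat T N D Z t (\<alpha> n)))
    (distr (chi_squared (T-t-1)) borel (\<lambda>x. limit_variance t * x / real (T-t-1)))"
proof -
  define I where "I = {1..T-t}"
  \<comment> \<open>The bound t \<le> T - 2 leaves at least two accident years, hence at least one
    degree of freedom.\<close>
  have I: "finite I" "I \<noteq> {}" "card I \<ge> 2" "I \<subseteq> {1..T}" using t by (auto simp: I_def)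
  have t': "t \<in> {1..T}" "t + 1 \<in> {1..T}" using t by auto
  define p where "p = real T - real t - 1"
  have p: "p > 0" "real (T - t - 1) = p" using t by (auto simp: p_def)
  define s where "s = residual_var t"
  have s: "s > 0" unfolding s_def by (rule residual_var_pos[OF t'(2)])
  define \<mu> where "\<mu> = mean_le t"
  have \<mu>: "\<mu> > 0" unfolding \<mu>_def by (rule mean_le_pos[OF t'(1)])
  have lam: "lam i > 0" if "i \<in> I" for i using exposure[of i] that I by auto
  define L where "L = sum lam I"
  have L: "L > 0" unfolding L_def by (rule sum_pos) (use I lam in auto)
  \<comment> \<open>With these weights |b|^2 = L, and (b.X)^2 / L has coefficients sqrt(lam_i lam_j)
    / L, which are \<mu> times the limits \<open>K'\<close> of the random coefficients.\<close>
  define b where "b i = sqrt (lam i)" for i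
  define X where "X n i \<omega> = normalized_sum t i (N i (\<alpha> n) \<omega>) \<omega>" for n i \<omega>
  define A where "A n i \<omega> = real (N i (\<alpha> n) \<omega>) / cum_claims N D Z i t (\<alpha> n) \<omega>" for n i \<omega>
  define K where "K n i j \<omega> = sqrt (real (N i (\<alpha> n) \<omega>) * real (N j (\<alpha> n) \<omega>)) / (\<Sum>i\<in>I. cum_claims N D Z i t (\<alpha> n) \<omega>)" for n i j \<omega>
  define K' where "K' i j = sqrt (lam i * lam j) / (L * \<mu>)" for i j
  define q where "q x = limit_variance t * residual_sum I b x / p" for x
  define Q where "Q n \<omega> = q (\<lambda>i\<in>I. X n i \<omega>)" for n \<omega>
  define Q' where "Q' n \<omega> = s / p * ((\<Sum>i\<in>I. (X n i \<omega>)\<^sup>2 * A n i \<omega>) - (\<Sum>i\<in>I. \<Sum>j\<in>I. X n i \<omega> * X n j \<omega> * K n i j \<omega>))" for n \<omega>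
  \<comment> \<open>The product of V and E dominates the error of freezing the coefficients: V
    converges in law, E tends to 0 almost surely.\<close>
  define V where "V n \<omega> = (\<Sum>i\<in>I. (X n i \<omega>)\<^sup>2)" for n \<omega>
  define E where "E n \<omega> = s / p * ((\<Sum>i\<in>I. \<bar>A n i \<omega> - 1 / \<mu>\<bar>) + (\<Sum>i\<in>I. \<Sum>j\<in>I. \<bar>K n i j \<omega> - K' i j\<bar>))" for n \<omega>
  have Xm[measurable]: "X n i \<in> borel_measurable M" if "i \<in> I" for n i
    unfolding X_def using normalized_sum_number_measurable[of i "\<alpha> n" t] that I \<alpha> by auto
  have Nm: "N i (\<alpha> n) \<in> measurable M (count_space UNIV)" if "i \<in> I" for n i
    using number_measurable[of i "\<alpha> n"] that I \<alpha> by auto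
  have Nm'[measurable]: "(\<lambda>\<omega>. real (N i (\<alpha> n) \<omega>)) \<in> borel_measurable M" if "i \<in> I" for n i
    by (rule measurable_compose[OF Nm[OF that]]) simp
  have Cm[measurable]: "cum_claims N D Z i r (\<alpha> n) \<in> borel_measurable M" if "i \<in> I" for n i r
    using cum_claims_measurable[of i "\<alpha> n" r] that I \<alpha> by auto
  have [measurable]: "A n i \<in> borel_measurable M" if "i \<in> I" for n i
    unfolding A_def using that by measurable
  have [measurable]: "K n i j \<in> borel_measurable M" if "i \<in> I" "j \<in> I" for n i j
    unfolding K_def using that by measurable
  have [measurable]: "q \<in> borel_measurable (PiM I (\<lambda>_. borel))" unfolding q_def by measurable
  have [measurable]: "Q n \<in> borel_measurable M" for n unfolding Q_def by measurable
  have [measurable]: "Q' n \<in> borel_measurable M" for n unfolding Q'_def by measurable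
  have [measurable]: "V n \<in> borel_measurable M" for n unfolding V_def by measurable
  have [measurable]: "E n \<in> borel_measurable M" for n unfolding E_def by measurable
  have Sm[measurable]: "sigma2hat T N D Z t (\<alpha> n) \<in> borel_measurable M" for n
    unfolding sigma2hat_def fhat_def I_def[symmetric] by measurable

  have ind: "indep_vars (\<lambda>_. borel) (X n) I" for n
    unfolding X_def by (rule normalized_sum_indep_years) (use I \<alpha> in auto)
  have Xconv: "weak_conv_m (\<lambda>n. distr M borel (X n i)) std_normal_distribution" if "i \<in> I" for i
    unfolding X_def using that I t' \<alpha> by (intro normalized_sum_number_weak_conv) auto

  have Q: "weak_conv_m (\<lambda>n. distr M borel (Q n)) (distr (PiM I (\<lambda>_. std_normal_distribution)) borel q)"
    unfolding Q_def
  proof (rule weak_conv_continuous_map_indep)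
    show "(\<lambda>n. q (x n)) \<longlonglongrightarrow> q y" if "\<And>i. i \<in> I \<Longrightarrow> (\<lambda>n. x n i) \<longlonglongrightarrow> y i" for x y
      unfolding q_def residual_sum_def weighted_mean_def
      by (intro tendsto_intros that) (use p L lam in \<open>auto simp: L_def b_def less_imp_le\<close>)
  qed (use I ind Xconv real_dist_normal_dist in auto)
  \<comment> \<open>The limit law is left as an image measure; its role is to bound V in
    probability.\<close>
  have V: "weak_conv_m (\<lambda>n. distr M borel (V n)) (distr (PiM I (\<lambda>_. std_normal_distribution)) borel (\<lambda>x. \<Sum>i\<in>I. (x i)\<^sup>2))"
  proof -
    have "weak_conv_m (\<lambda>n. distr M borel (\<lambda>\<omega>. \<Sum>i\<in>I. ((\<lambda>i\<in>I. X n i \<omega>) i)\<^sup>2)) (distr (PiM I (\<lambda>_. std_normal_distribution)) borel (\<lambda>x. \<Sum>i\<in>I. (x i)\<^sup>2))"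
      by (rule weak_conv_continuous_map_indep) (use I ind Xconv real_dist_normal_dist in \<open>auto intro!: tendsto_intros\<close>)
    then show ?thesis unfolding V_def by simp
  qed

  interpret PN: product_prob_space "\<lambda>_. std_normal_distribution" I
    by (intro product_prob_spaceI prob_space_std_normal)
  have [measurable]: "(\<lambda>x. \<Sum>i\<in>I. (x i)\<^sup>2) \<in> borel_measurable (PiM I (\<lambda>_. std_normal_distribution))" by measurable
  have [measurable]: "q \<in> borel_measurable (PiM I (\<lambda>_. std_normal_distribution))" by measurable

  have bound: "\<bar>Q' n \<omega> - Q n \<omega>\<bar> \<le> V n \<omega> * E n \<omega>" for n \<omega>
  proof -
    have bs: "(\<Sum>i\<in>I. (b i)\<^sup>2) = L" unfolding L_def b_def using lam by (intro sum.cong) (auto simp: less_imp_le)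
    have bx: "(\<Sum>i\<in>I. b i * X n i \<omega>)\<^sup>2 = (\<Sum>i\<in>I. \<Sum>j\<in>I. X n i \<omega> * X n j \<omega> * sqrt (lam i * lam j))"
      by (simp add: power2_eq_square sum_product b_def real_sqrt_mult mult_ac)
    define U where "U = (\<Sum>i\<in>I. (X n i \<omega>)\<^sup>2)"
    define W where "W = (\<Sum>i\<in>I. \<Sum>j\<in>I. X n i \<omega> * X n j \<omega> * sqrt (lam i * lam j))"
    have "residual_sum I b (\<lambda>i\<in>I. X n i \<omega>) = U - W / L"
      using L by (simp add: residual_sum_def weighted_mean_def bs power_divide bx U_def W_def)
    \<comment> \<open>By \<open>limit_variance_eq\<close> the scale is s / \<mu>, so Q and Q' share
      the prefactor s / p and differ only in coefficients: 1 / \<mu> against A, and K' against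
      K.\<close>
    then have "Q n \<omega> = s / \<mu> * (U - W / L) / p"
      unfolding Q_def q_def limit_variance_eq[OF t'] s_def[symmetric] \<mu>_def[symmetric] by (simp only:)
    also have "\<dots> = s / p * (U / \<mu> - W / (L * \<mu>))"
      using \<mu> L p by (simp add: divide_simps)
    finally have "Q n \<omega> = s / p * (U / \<mu> - W / (L * \<mu>))" .
    moreover have "U / \<mu> = (\<Sum>i\<in>I. (X n i \<omega>)\<^sup>2 * (1 / \<mu>))"
      unfolding U_def sum_distrib_right[symmetric] by simp
    moreover have "W / (L * \<mu>) = (\<Sum>i\<in>I. \<Sum>j\<in>I. X n i \<omega> * X n j \<omega> * K' i j)"
      unfolding W_def K'_def sum_divide_distrib times_divide_eq_right ..
    ultimately have "Q n \<omega> = s / p * ((\<Sum>i\<in>I. (X n i \<omega>)\<^sup>2 * (1 / \<mu>)) - (\<Sum>i\<in>I. \<Sum>j\<in>I. X n i \<omega> * X n j \<omega> * K' i j))"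
      by (simp only:)
    then have "Q' n \<omega> - Q n \<omega> = s / p * (((\<Sum>i\<in>I. (X n i \<omega>)\<^sup>2 * A n i \<omega>) - (\<Sum>i\<in>I. \<Sum>j\<in>I. X n i \<omega> * X n j \<omega> * K n i j \<omega>))
       - ((\<Sum>i\<in>I. (X n i \<omega>)\<^sup>2 * (1 / \<mu>)) - (\<Sum>i\<in>I. \<Sum>j\<in>I. X n i \<omega> * X n j \<omega> * K' i j)))"
      unfolding Q'_def by (simp only: right_diff_distrib[of "s / p"])
    then have "\<bar>Q' n \<omega> - Q n \<omega>\<bar> \<le> s / p * (V n \<omega> * ((\<Sum>i\<in>I. \<bar>A n i \<omega> - 1 / \<mu>\<bar>) + (\<Sum>i\<in>I. \<Sum>j\<in>I. \<bar>K n i j \<omega> - K' i j\<bar>)))"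
      unfolding V_def
      by (simp only: abs_mult[of "s / p"] abs_of_pos[OF divide_pos_pos[OF s p(1)]],
          intro mult_left_mono quadratic_form_perturbation I less_imp_le divide_pos_pos s p)
    then show ?thesis by (simp add: E_def mult_ac)
  qed

  have limits: "AE \<omega> in M. (\<forall>i\<in>I. (\<lambda>n. A n i \<omega>) \<longlonglongrightarrow> 1 / \<mu> \<and> (\<forall>j\<in>I. (\<lambda>n. K n i j \<omega>) \<longlonglongrightarrow> K' i j))
    \<and> (\<forall>\<^sub>F n in sequentially. \<forall>i\<in>I. cum_claims N D Z i t (\<alpha> n) \<omega> > 0)"
    using AE_asymptotics
  proof eventually_elim
    case (elim \<omega>)
    define n' where "n' i n = real (N i (\<alpha> n) \<omega>) / \<alpha> n" for i n
    define c' where "c' i n = cum_claims N D Z i t (\<alpha> n) \<omega> / \<alpha> n" for i n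
    have n': "n' i \<longlonglongrightarrow> lam i" if "i \<in> I" for i
      unfolding n'_def using elim that I by (intro filterlim_compose[OF _ \<alpha>(2)]) auto
    have c': "c' i \<longlonglongrightarrow> lam i * \<mu>" if "i \<in> I" for i
      unfolding c'_def \<mu>_def using elim that I by (intro filterlim_compose[OF _ \<alpha>(2)]) auto
    have pos: "\<forall>\<^sub>F n in sequentially. \<alpha> n > 0"
      using \<alpha>(2) by (simp add: filterlim_at_top_dense)
    have "(\<lambda>n. A n i \<omega>) \<longlonglongrightarrow> 1 / \<mu>" if "i \<in> I" for i
    proof -
      have "(\<lambda>n. n' i n / c' i n) \<longlonglongrightarrow> lam i / (lam i * \<mu>)"
        using lam[OF that] \<mu> that by (intro tendsto_divide n' c') auto
      then have "(\<lambda>n. n' i n / c' i n) \<longlonglongrightarrow> 1 / \<mu>" using lam[OF that] by simp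
      then show ?thesis
        by (rule Lim_transform_eventually) (use pos in eventually_elim, simp add: A_def n'_def c'_def)
    qed
    moreover have "(\<lambda>n. K n i j \<omega>) \<longlonglongrightarrow> K' i j" if "i \<in> I" "j \<in> I" for i j
    proof -
      have "(\<lambda>n. sqrt (n' i n * n' j n) / (\<Sum>i\<in>I. c' i n)) \<longlonglongrightarrow> sqrt (lam i * lam j) / (\<Sum>i\<in>I. lam i * \<mu>)"
        using L \<mu> that by (intro tendsto_divide tendsto_real_sqrt tendsto_mult tendsto_sum n' c') (auto simp: sum_distrib_right[symmetric] L_def)
      then have "(\<lambda>n. sqrt (n' i n * n' j n) / (\<Sum>i\<in>I. c' i n)) \<longlonglongrightarrow> K' i j"
        by (simp add: K'_def L_def sum_distrib_right)
      then show ?thesis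
      proof (rule Lim_transform_eventually)
        show "\<forall>\<^sub>F n in sequentially. sqrt (n' i n * n' j n) / (\<Sum>i\<in>I. c' i n) = K n i j \<omega>"
          using pos
        proof eventually_elim
          case (elim n)
          have "sqrt (n' i n * n' j n) = sqrt (real (N i (\<alpha> n) \<omega>) * real (N j (\<alpha> n) \<omega>)) / \<alpha> n"
            using elim by (simp add: n'_def real_sqrt_divide real_sqrt_mult)
          then show ?case using elim by (simp add: K_def c'_def sum_divide_distrib[symmetric])
        qed
      qed
    qed
    moreover have "\<forall>\<^sub>F n in sequentially. \<forall>i\<in>I. cum_claims N D Z i t (\<alpha> n) \<omega> > 0"
    proof (rule eventually_ball_finite[OF I(1)], rule ballI)
      fix i assume i: "i \<in> I"
      have "\<forall>\<^sub>F n in sequentially. c' i n > 0"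
        using lam[OF i] \<mu> by (intro order_tendstoD(1)[OF c'[OF i]]) auto
      then show "\<forall>\<^sub>F n in sequentially. cum_claims N D Z i t (\<alpha> n) \<omega> > 0"
        using pos by eventually_elim (simp add: c'_def zero_less_divide_iff)
    qed
    ultimately show ?case by blast
  qed

  have E: "AE \<omega> in M. (\<lambda>n. E n \<omega>) \<longlonglongrightarrow> 0"
    using limits
  proof eventually_elim
    case (elim \<omega>)
    have "(\<lambda>n. E n \<omega>) \<longlonglongrightarrow> s / p * ((\<Sum>i\<in>I. \<bar>1 / \<mu> - 1 / \<mu>\<bar>) + (\<Sum>i\<in>I. \<Sum>j\<in>I. \<bar>K' i j - K' i j\<bar>))"
      unfolding E_def by (intro tendsto_intros) (use elim in auto)
    then show ?case by simp
  qed
  have Q': "weak_conv_m (\<lambda>n. distr M borel (Q' n)) (distr (PiM I (\<lambda>_. std_normal_distribution)) borel q)"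
  proof (rule weak_conv_Slutsky[OF _ _ _ Q])
    fix e :: real assume e: "e > 0"
    have "(\<lambda>n. prob {\<omega>\<in>space M. \<bar>V n \<omega> * E n \<omega>\<bar> > e}) \<longlonglongrightarrow> 0"
      by (rule prob_abs_mult_gt_tendsto_0[OF _ _ _ V E e]) (auto intro!: PN.real_distribution_distr)
    then show "(\<lambda>n. prob {\<omega>\<in>space M. \<bar>Q' n \<omega> - Q n \<omega>\<bar> > e}) \<longlonglongrightarrow> 0"
    proof (rule tendsto_sandwich[rotated 2, OF tendsto_const])
      show "\<forall>\<^sub>F n in sequentially. prob {\<omega>\<in>space M. \<bar>Q' n \<omega> - Q n \<omega>\<bar> > e} \<le> prob {\<omega>\<in>space M. \<bar>V n \<omega> * E n \<omega>\<bar> > e}"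
      proof (intro always_eventually allI finite_measure_mono)
        fix n
        show "{\<omega>\<in>space M. \<bar>Q' n \<omega> - Q n \<omega>\<bar> > e} \<subseteq> {\<omega>\<in>space M. \<bar>V n \<omega> * E n \<omega>\<bar> > e}"
          using bound[of n] by (auto intro: less_le_trans order_trans[OF _ abs_ge_self])
      qed measurable
    qed simp
  qed (auto intro!: PN.real_distribution_distr)
  \<comment> \<open>The estimator equals Q' wherever all cumulative claims are positive. On almost
    every path this holds from some index on, so the difference is eventually 0 and vanishes in
    probability.\<close>
  have wc: "weak_conv_m (\<lambda>n. distr M borel (sigma2hat T N D Z t (\<alpha> n))) (distr (PiM I (\<lambda>_. std_normal_distribution)) borel q)"
  proof (rule weak_conv_Slutsky[OF _ _ _ Q'])
    fix e :: real assume e: "e > 0"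
    show "(\<lambda>n. prob {\<omega>\<in>space M. \<bar>sigma2hat T N D Z t (\<alpha> n) \<omega> - Q' n \<omega>\<bar> > e}) \<longlonglongrightarrow> 0"
    proof (rule prob_abs_gt_tendsto_0_of_AE[OF _ _ e])
      show "AE \<omega> in M. (\<lambda>n. sigma2hat T N D Z t (\<alpha> n) \<omega> - Q' n \<omega>) \<longlonglongrightarrow> 0"
        using limits
      proof eventually_elim
        case (elim \<omega>)
        then have "\<forall>\<^sub>F n in sequentially. \<forall>i\<in>I. cum_claims N D Z i t (\<alpha> n) \<omega> > 0" by blast
        then have "\<forall>\<^sub>F n in sequentially. sigma2hat T N D Z t (\<alpha> n) \<omega> - Q' n \<omega> = 0"
        proof eventually_elim
          case (elim n)
          then show ?case
            using sigma2hat_eq_quadratic_form[OF t, of "\<alpha> n" \<omega>]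
            by (simp add: Q'_def A_def K_def X_def I_def s_def p_def)
        qed
        then show ?case by (rule tendsto_eventually)
      qed
    qed measurable
  qed (auto intro!: PN.real_distribution_distr)
  have "distr (PiM I (\<lambda>_. std_normal_distribution)) borel q
    = distr (distr (PiM I (\<lambda>_. std_normal_distribution)) borel (residual_sum I b)) borel (\<lambda>x. limit_variance t * x / p)"
    unfolding q_def[abs_def] by (subst distr_distr) (auto simp: comp_def)
  moreover have "distr (PiM I (\<lambda>_. std_normal_distribution)) borel (residual_sum I b) = chi_squared (T - t - 1)"
    using distr_residual_sum[OF I(1,3), of b] lam by (simp add: b_def I_def)
  ultimately show ?thesis using wc unfolding p(2) by (simp only:)
qed

text \<open>A limit at infinity in a real parameter may be checked along all sequences tending to
  infinity, and points of mass zero are exactly the continuity points of the distribution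
  function.\<close>

lemma sigma2hat_conv_in_distr:
  assumes t: "t \<in> {1..T-2}"
  shows "conv_in_distr M (sigma2hat T N D Z t) at_top (distr (chi_squared (T-t-1)) borel (\<lambda>x. limit_variance t * x / real (T-t-1)))"
  unfolding conv_in_distr_def
proof (intro allI impI tendsto_at_topI_sequentially)
  let ?L = "distr (chi_squared (T-t-1)) borel (\<lambda>x. limit_variance t * x / real (T-t-1))"
  fix x :: real and \<beta> :: "nat \<Rightarrow> real"
  assume x: "measure ?L {x} = 0" and \<beta>: "filterlim \<beta> at_top sequentially"
  \<comment> \<open>Clipping at 0 provides the nonnegative exposures required for measurability and
    alters only finitely many terms.\<close>
  define \<alpha> where "\<alpha> n = max 0 (\<beta> n)" for n
  have ev: "\<forall>\<^sub>F n in sequentially. \<alpha> n = \<beta> n"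
    using filterlim_at_top_dense[THEN iffD1, OF \<beta>, rule_format, of 0] by eventually_elim (simp add: \<alpha>_def)
  have "filterlim \<alpha> at_top sequentially"
    by (rule filterlim_cong[THEN iffD2, OF refl refl ev \<beta>])
  have \<alpha>: "\<alpha> n \<ge> 0" for n by (simp add: \<alpha>_def)
  have wc: "weak_conv_m (\<lambda>n. distr M borel (sigma2hat T N D Z t (\<alpha> n))) ?L"
    by (rule sigma2hat_weak_conv[OF t \<alpha>]) fact
  have "T - t - 1 > 0" using t by auto
  then have "prob_space (chi_squared (T-t-1))"
    using prob_space_sum_squares_law[of "T-t-1"] by (simp add: sum_squares_law_eq_chi_squared)
  then interpret \<chi>: prob_space "chi_squared (T-t-1)" .
  interpret L: real_distribution ?L by (rule \<chi>.real_distribution_distr) (simp add: chi_squared_def)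
  have "isCont (cdf ?L) x" using x by (simp only: L.isCont_cdf)
  then have "(\<lambda>n. cdf (distr M borel (sigma2hat T N D Z t (\<alpha> n))) x) \<longlonglongrightarrow> cdf ?L x"
    using wc by (simp add: weak_conv_m_def weak_conv_def)
  moreover have "cdf (distr M borel (sigma2hat T N D Z t (\<alpha> n))) x = prob {\<omega> \<in> space M. sigma2hat T N D Z t (\<alpha> n) \<omega> \<le> x}" for n
  proof -
    have [measurable]: "cum_claims N D Z i r (\<alpha> n) \<in> borel_measurable M" if "i \<in> {1..T-t}" for i r
      using cum_claims_measurable[OF _ \<alpha>[of n], of i r] that by auto
    have "sigma2hat T N D Z t (\<alpha> n) \<in> borel_measurable M"
      unfolding sigma2hat_def fhat_def by measurable
    then show ?thesis
      unfolding cdf_def by (subst measure_distr) (auto intro!: arg_cong[of _ _ prob])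
  qed
  ultimately have "(\<lambda>n. prob {\<omega> \<in> space M. sigma2hat T N D Z t (\<alpha> n) \<omega> \<le> x}) \<longlonglongrightarrow> measure ?L {..x}"
    by (simp add: cdf_def)
  then show "(\<lambda>n. prob {\<omega> \<in> space M. sigma2hat T N D Z t (\<beta> n) \<omega> \<le> x}) \<longlonglongrightarrow> measure ?L {..x}"
    by (rule Lim_transform_eventually) (use ev in eventually_elim, simp)
qed

end

theorem theorem1:
  fixes M :: "'a measure" and T :: nat
    and N :: "nat \<Rightarrow> real \<Rightarrow> 'a \<Rightarrow> nat"
    and D :: "nat \<Rightarrow> nat \<Rightarrow> 'a \<Rightarrow> nat"
    and Z :: "nat \<Rightarrow> nat \<Rightarrow> 'a \<Rightarrow> real"
    and P :: "(nat \<times> real) measure"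
    and lam :: "nat \<Rightarrow> real"
  assumes prob: "prob_space M"
    and T2: "T \<ge> 2"
    and D_range: "\<And>i k \<omega>. i \<in> {1..T} \<Longrightarrow> k \<ge> 1 \<Longrightarrow> \<omega> \<in> space M \<Longrightarrow> D i k \<omega> \<in> {1..T}"
    \<comment> \<open>(GM1): i.i.d. in k, common law P not depending on i\<close>
    and GM1_indep: "\<And>i. i \<in> {1..T} \<Longrightarrow>
       prob_space.indep_vars M (\<lambda>_. count_space UNIV \<Otimes>\<^sub>M borel) (\<lambda>k \<omega>. (D i k \<omega>, Z i k \<omega>)) {1::nat..}"
    and GM1_distr: "\<And>i k. i \<in> {1..T} \<Longrightarrow> k \<ge> 1 \<Longrightarrow>
       distr M (count_space UNIV \<Otimes>\<^sub>M borel) (\<lambda>\<omega>. (D i k \<omega>, Z i k \<omega>)) = P"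
    and GM1_sq: "integrable P (\<lambda>x. (snd x)\<^sup>2)"
    and GM1_pos: "\<And>t. t \<in> {1..T} \<Longrightarrow> (\<integral>x. (if fst x = t then snd x else 0) \<partial>P) > 0"
    \<comment> \<open>(GM2): claims independent of the claim-number process\<close>
    and GM2: "\<And>i. i \<in> {1..T} \<Longrightarrow>
       indep_rvs M
         (Pi\<^sub>M {1::nat..} (\<lambda>_. count_space UNIV \<Otimes>\<^sub>M borel)) (\<lambda>\<omega>. \<lambda>k\<in>{1::nat..}. (D i k \<omega>, Z i k \<omega>))
         (Pi\<^sub>M {0::real..} (\<lambda>_. count_space UNIV)) (\<lambda>\<omega>. \<lambda>\<alpha>\<in>{0::real..}. N i \<alpha> \<omega>)"
    \<comment> \<open>(GM3): independence across accident years\<close>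
    and GM3: "prob_space.indep_vars M
       (\<lambda>_. Pi\<^sub>M {0::real..} (\<lambda>_. count_space UNIV) \<Otimes>\<^sub>M Pi\<^sub>M {1::nat..} (\<lambda>_. count_space UNIV \<Otimes>\<^sub>M borel))
       (\<lambda>i \<omega>. (\<lambda>\<alpha>\<in>{0::real..}. N i \<alpha> \<omega>, \<lambda>k\<in>{1::nat..}. (D i k \<omega>, Z i k \<omega>))) {1..T}"
    \<comment> \<open>(GM4)\<close>
    and GM4: "\<And>i. i \<in> {1..T} \<Longrightarrow> lam i > 0 \<and>
       (AE \<omega> in M. ((\<lambda>\<alpha>. real (N i \<alpha> \<omega>) / \<alpha>) \<longlongrightarrow> lam i) at_top)"
  defines "EZle \<equiv> \<lambda>t::nat. \<integral>x. (if fst x \<le> t then snd x else 0) \<partial>P"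
    and "EZ2le \<equiv> \<lambda>t::nat. \<integral>x. (if fst x \<le> t then (snd x)\<^sup>2 else 0) \<partial>P"
    and "EZeq \<equiv> \<lambda>t::nat. \<integral>x. (if fst x = t then snd x else 0) \<partial>P"
    and "EZ2eq \<equiv> \<lambda>t::nat. \<integral>x. (if fst x = t then (snd x)\<^sup>2 else 0) \<partial>P"
  defines "f \<equiv> \<lambda>t. EZle (t+1) / EZle t"
  defines "sigma2 \<equiv> \<lambda>t. (f t - 1) * (EZ2eq (t+1) / EZeq (t+1) + (f t - 1) * (EZ2le t / EZle t))"
  shows
    "(\<forall>t\<in>{1..T-1}. AE \<omega> in M. ((\<lambda>\<alpha>. fhat T N D Z t \<alpha> \<omega>) \<longlongrightarrow> f t) at_top)
     \<and> (\<forall>i\<in>{2..T}. AE \<omega> in M.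
          ((\<lambda>\<alpha>. cum_claims N D Z i (T-i+1) \<alpha> \<omega> * (\<Prod>t\<in>{T-i+1..T-1}. fhat T N D Z t \<alpha> \<omega>)
                 / cum_claims N D Z i T \<alpha> \<omega>) \<longlongrightarrow> 1) at_top)
     \<and> (\<forall>t\<in>{1..T-2}. conv_in_distr M (sigma2hat T N D Z t) at_top
          (distr (chi_squared (T-t-1)) borel (\<lambda>x. sigma2 t * x / real (T-t-1))))"
proof -
  interpret chain_ladder M T N D Z P lam
    by (rule chain_ladder.intro[OF prob], rule chain_ladder_axioms.intro)
       (fact T2 D_range GM1_indep GM1_distr GM1_sq GM1_pos GM2 GM3 GM4)+
  have f: "f = dev_factor"
    by (rule ext) (simp add: f_def EZle_def dev_factor_def mean_le_def)
  have sigma2: "sigma2 = limit_variance"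
    by (rule ext) (simp add: sigma2_def f limit_variance_def EZ2eq_def EZeq_def EZ2le_def EZle_def sq_eq_def mean_eq_def sq_le_def mean_le_def)
  have asymptotics: "AE \<omega> in M. \<forall>i\<in>{1..T}. \<forall>t. ((\<lambda>\<alpha>. cum_claims N D Z i t \<alpha> \<omega> / \<alpha>) \<longlongrightarrow> lam i * mean_le t) at_top"
    using AE_asymptotics by (rule eventually_mono) blast
  show ?thesis
  proof (intro conjI ballI)
    show "AE \<omega> in M. ((\<lambda>\<alpha>. fhat T N D Z t \<alpha> \<omega>) \<longlongrightarrow> f t) at_top" if "t \<in> {1..T-1}" for t
      unfolding f using asymptotics by (rule eventually_mono) (rule fhat_tendsto[OF _ that])
    show "AE \<omega> in M. ((\<lambda>\<alpha>. cum_claims N D Z i (T-i+1) \<alpha> \<omega> * (\<Prod>t\<in>{T-i+1..T-1}. fhat T N D Z t \<alpha> \<omega>)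
                 / cum_claims N D Z i T \<alpha> \<omega>) \<longlongrightarrow> 1) at_top" if "i \<in> {2..T}" for i
      using asymptotics by (rule eventually_mono) (rule ultimate_ratio_tendsto[OF _ that])
    show "conv_in_distr M (sigma2hat T N D Z t) at_top
          (distr (chi_squared (T-t-1)) borel (\<lambda>x. sigma2 t * x / real (T-t-1)))" if "t \<in> {1..T-2}" for t
      unfolding sigma2 by (rule sigma2hat_conv_in_distr[OF that])
  qed
qed

end
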